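(* Let $b\neq0$ be a constant, $\alpha=5/b$, and consider the Lax pair of $6\times6$ matrix differential operators $$L=\mathrm{i}\partial_x+Q(x,t)-\lambda J,\qquad M=\mathrm{i}\partial_t+V^{(0)}(x,t)+\lambda V^{(1)}(x,t)+\lambda^2V^{(2)}(x,t)-\lambda^3K,$$ where $$Q=\mathrm{i}\sum_{j=1}^3q_j(x,t)\mathcal{E}^+_{jj},\quad J=\mathcal{E}^+_{21}+\mathcal{E}^+_{32}+\tfrac12\mathcal{E}^+_{43}+\tfrac12\mathcal{E}^-_{15},\quad K=bJ^3,$$ $$V^{(0)}=\sum_{j=1}^3v^{(0)}_j\mathcal{E}^+_{jj},\quad V^{(1)}=v^{(1)}_1\mathcal{E}^+_{21}+v^{(1)}_2\mathcal{E}^+_{32}+\tfrac12v^{(1)}_3\mathcal{E}^+_{43}+\tfrac12v^{(1)}_4\mathcal{E}^-_{15},$$ $$V^{(2)}=-v^{(2)}_1\mathcal{E}^+_{31}-v^{(2)}_2\mathcal{E}^+_{42}-\tfrac12v^{(2)}_3\mathcal{E}^-_{14}.$$ The condition $[L,M]=0$ (for any $\lambda$) leads to a set of recurrent relations which allow one to determine the $V^{(k)}(x,t)$ in terms of the potential $Q(x,t)$ and its $x$-derivatives, with the following result. For $V^{(2)}$ one finds $$v^{(2)}_1=-\mathrm{i}b(q_1+q_2+q_3),\quad v^{(2)}_2=-\mathrm{i}bq_2,\quad v^{(2)}_3=-\mathrm{i}b(q_1-q_2-q_3).$$ For $V^{(1)}$ one finds $$v^{(1)}_1=2b\left(q_1q_2-\tfrac{\partial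 q_1}{\partial x}\right)+f,$$ $$v^{(1)}_2=b\left(q_3^2-q_1^2+q_1q_2+q_2q_3+\tfrac{\partial}{\partial x}(q_3+q_2-q_1)\right)+f,$$ $$v^{(1)}_3=b\left(q_3^2-q_2^2-q_1^2+q_1q_2+\tfrac{\partial}{\partial x}(q_3+2q_2-q_1)\right)+f,\qquad v^{(1)}_4=f,$$ where at this stage $f(x,t)$ is an arbitrary function. From the equations for $V^{(0)}$ one finds also $f$, $$f=\tfrac b5\left(2q_2^2+2q_1^2-3q_3^2-5q_1q_2+\tfrac{\partial}{\partial x}(5q_1-4q_2-3q_3)\right),$$ and $v^{(0)}_j=\frac{\mathrm{i}b}5F_j$, $j=1,2,3$, where $$F_1=-5\tfrac{\partial^2q_1}{\partial x^2}+3q_1\tfrac{\partial}{\partial x}(3q_2+q_3)-2q_1^3+3q_1(q_2^2+q_3^2),$$ $$F_2=\tfrac{\partial^2}{\partial x^2}(4q_2+3q_3)+3q_2\tfrac{\partial q_3}{\partial x}-9q_1\tfrac{\partial q_1}{\partial x}+6q_3\tfrac{\partial q_3}{\partial x}-2q_2^3+3q_2(q_1^2+q_3^2),$$ $$F_3=\tfrac{\partial^2}{\partial x^2}(q_3+3q_2)-6q_3\tfrac{\partial q_2}{\partial x}-3q_1\tfrac{\partial q_1}{\partial x}-3q_2\tfrac{\partial q_2}{\partial x}-2q_3^3+3q_3(q_1^2+q_2^2).$$ Finally, the $\lambda$-independent terms of $[L,M]=0$ provide the system of mKdV-type equations $$\alpha\frac{\partial q_j}{\partial t}=\frac{\partial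 F_j}{\partial x},\qquad j=1,2,3.$$
   Context: $E_{i,j}$ is the $6\times6$ matrix unit with entry $1$ in position $(i,j)$ and $0$ elsewhere, and $\mathcal{E}^\pm_{ij}=E_{i,j}\mp(-1)^{i+j}E_{7-j,7-i}$. $\lambda$ is a complex spectral parameter, $q_j$ and $v^{(k)}_j$ are functions of $(x,t)$, and $[L,M]=LM-ML$. The system is associated with the twisted affine Kac-Moody algebra $A_5^{(2)}$.
   Formalization: The equations for V^(0) fix f only up to an added function c(t); the formal text proves this general form (v^(0)_j and the system gain c-terms) and the stated f, v^(0)_j and mKdV system when this integration constant is zero, e.g. for fields vanishing as x→−∞. *)

theory Defs
  imports "HOL-Analysis.Analysis"
begin

section \<open>Functions of two real variables\<close>

type_synonym 'a field2 = "real \<Rightarrow> real \<Rightarrow> 'a"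

definition Dx :: "'a::real_normed_vector field2 \<Rightarrow> 'a field2" where
  "Dx u = (\<lambda>x t. vector_derivative (\<lambda>y. u y t) (at x))"

definition Dt :: "'a::real_normed_vector field2 \<Rightarrow> 'a field2" where
  "Dt u = (\<lambda>x t. vector_derivative (\<lambda>s. u x s) (at t))"

primrec Ck :: "nat \<Rightarrow> 'a::real_normed_vector field2 \<Rightarrow> bool" where
  "Ck 0 u \<longleftrightarrow> continuous_on UNIV (\<lambda>(x, t). u x t)"
| "Ck (Suc n) u \<longleftrightarrow>
     continuous_on UNIV (\<lambda>(x, t). u x t) \<and>
     (\<forall>x t. (\<lambda>y. u y t) differentiable at x \<and> (\<lambda>s. u x s) differentiable at t) \<and>
     Ck n (Dx u) \<and> Ck n (Dt u)"

definition smooth :: "'a::real_normed_vector field2 \<Rightarrow> bool" where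
  "smooth u \<longleftrightarrow> (\<forall>n. Ck n u)"


section \<open>Matrices\<close>

type_synonym vec6 = "complex ^ 6"
type_synonym mat6 = "complex ^ 6 ^ 6"

definition smult_mat6 :: "complex \<Rightarrow> mat6 \<Rightarrow> mat6"  (infixr "*\<^sub>M" 75) where
  "c *\<^sub>M A = (\<chi> a b. c * A $ a $ b)"

definition mcomm :: "mat6 \<Rightarrow> mat6 \<Rightarrow> mat6" where
  "mcomm A B = A ** B - B ** A"

text \<open>Rows and columns are labelled 1, ..., 6 by natural numbers. The elements of the index type
  are the residues modulo 6, so label 6 is carried by the index 0; on 1, ..., 6 the map
  \<^term>\<open>of_nat :: nat \<Rightarrow> 6\<close> is a bijection onto the index type.\<close>

definition E :: "nat \<Rightarrow> nat \<Rightarrow> mat6" where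
  "E i j = (\<chi> a b. if a = of_nat i \<and> b = of_nat j then 1 else 0)"

definition Ep :: "nat \<Rightarrow> nat \<Rightarrow> mat6" where
  "Ep i j = E i j - ((- 1) ^ (i + j)) *\<^sub>M E (7 - j) (7 - i)"

definition Em :: "nat \<Rightarrow> nat \<Rightarrow> mat6" where
  "Em i j = E i j + ((- 1) ^ (i + j)) *\<^sub>M E (7 - j) (7 - i)"


section \<open>The Lax pair\<close>

text \<open>The fields \<open>q\<^sub>j\<close> are \<open>q j\<close> with j = 1, 2, 3, and \<open>v\<^sub>j\<^bsup>(k)\<^esup>\<close> is \<open>v k j\<close> with
  j = 1, 2, 3 for k = 0 and k = 2, and j = 1, 2, 3, 4 for k = 1.\<close>

definition Qmat :: "(nat \<Rightarrow> complex field2) \<Rightarrow> mat6 field2" where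
  "Qmat q = (\<lambda>x t. \<i> *\<^sub>M (\<Sum>j = 1..3. q j x t *\<^sub>M Ep j j))"

definition Jmat :: mat6 where
  "Jmat = Ep 2 1 + Ep 3 2 + (1/2) *\<^sub>M Ep 4 3 + (1/2) *\<^sub>M Em 1 5"

definition Kmat :: "complex \<Rightarrow> mat6" where
  "Kmat b = b *\<^sub>M (Jmat ** Jmat ** Jmat)"

definition V0mat :: "(nat \<Rightarrow> nat \<Rightarrow> complex field2) \<Rightarrow> mat6 field2" where
  "V0mat v = (\<lambda>x t. \<Sum>j = 1..3. v 0 j x t *\<^sub>M Ep j j)"

definition V1mat :: "(nat \<Rightarrow> nat \<Rightarrow> complex field2) \<Rightarrow> mat6 field2" where
  "V1mat v = (\<lambda>x t. v 1 1 x t *\<^sub>M Ep 2 1 + v 1 2 x t *\<^sub>M Ep 3 2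
                  + (1/2 * v 1 3 x t) *\<^sub>M Ep 4 3 + (1/2 * v 1 4 x t) *\<^sub>M Em 1 5)"

definition V2mat :: "(nat \<Rightarrow> nat \<Rightarrow> complex field2) \<Rightarrow> mat6 field2" where
  "V2mat v = (\<lambda>x t. - (v 2 1 x t *\<^sub>M Ep 3 1) - v 2 2 x t *\<^sub>M Ep 4 2
                  - (1/2 * v 2 3 x t) *\<^sub>M Em 1 4)"

text \<open>The matrix differential operators L and M at the value \<open>\<zeta>\<close> of the spectral parameter.\<close>

definition lax_L ::
  "(nat \<Rightarrow> complex field2) \<Rightarrow> complex \<Rightarrow> vec6 field2 \<Rightarrow> vec6 field2" where
  "lax_L q \<zeta> \<psi> = (\<lambda>x t. \<i> *s Dx \<psi> x t + (Qmat q x t - \<zeta> *\<^sub>M Jmat) *v \<psi> x t)"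

definition lax_M ::
  "complex \<Rightarrow> (nat \<Rightarrow> nat \<Rightarrow> complex field2) \<Rightarrow> complex \<Rightarrow> vec6 field2 \<Rightarrow> vec6 field2" where
  "lax_M b v \<zeta> \<psi> = (\<lambda>x t. \<i> *s Dt \<psi> x t
     + (V0mat v x t + \<zeta> *\<^sub>M V1mat v x t + \<zeta>^2 *\<^sub>M V2mat v x t - \<zeta>^3 *\<^sub>M Kmat b) *v \<psi> x t)"

definition op_comm ::
  "(vec6 field2 \<Rightarrow> vec6 field2) \<Rightarrow> (vec6 field2 \<Rightarrow> vec6 field2) \<Rightarrow> vec6 field2 \<Rightarrow> vec6 field2" where
  "op_comm A B \<psi> = (\<lambda>x t. A (B \<psi>) x t - B (A \<psi>) x t)"

definition lax_commute ::
  "complex \<Rightarrow> (nat \<Rightarrow> complex field2) \<Rightarrow> (nat \<Rightarrow> nat \<Rightarrow> complex field2) \<Rightarrow> bool" where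
  "lax_commute b q v \<longleftrightarrow>
     (\<forall>\<zeta> \<psi>. smooth \<psi> \<longrightarrow> (\<forall>x t. op_comm (lax_L q \<zeta>) (lax_M b v \<zeta>) \<psi> x t = 0))"

text \<open>\<open>lax_coeff b q v k\<close> is the coefficient of \<open>\<zeta>\<^sup>k\<close> in [L,M], a multiplication operator. Its vanishing
  for k = 3, 2, 1 is the recurrence for \<open>V\<^bsup>(2)\<^esup>\<close>, \<open>V\<^bsup>(1)\<^esup>\<close>, \<open>V\<^bsup>(0)\<^esup>\<close>.\<close>

definition lax_coeff ::
  "complex \<Rightarrow> (nat \<Rightarrow> complex field2) \<Rightarrow> (nat \<Rightarrow> nat \<Rightarrow> complex field2) \<Rightarrow> nat \<Rightarrow> mat6 field2" where
  "lax_coeff b q v k = (\<lambda>x t.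
     if k = 0 then
       \<i> *\<^sub>M Dx (V0mat v) x t - \<i> *\<^sub>M Dt (Qmat q) x t + mcomm (Qmat q x t) (V0mat v x t)
     else if k = 1 then
       \<i> *\<^sub>M Dx (V1mat v) x t + mcomm (Qmat q x t) (V1mat v x t) - mcomm Jmat (V0mat v x t)
     else if k = 2 then
       \<i> *\<^sub>M Dx (V2mat v) x t + mcomm (Qmat q x t) (V2mat v x t) - mcomm Jmat (V1mat v x t)
     else if k = 3 then
       - mcomm (Qmat q x t) (Kmat b) - mcomm Jmat (V2mat v x t)
     else if k = 4 then
       mcomm Jmat (Kmat b)
     else 0)"


section \<open>The explicit formulas\<close>

definition v2_formula ::
  "complex \<Rightarrow> (nat \<Rightarrow> complex field2) \<Rightarrow> (nat \<Rightarrow> nat \<Rightarrow> complex field2) \<Rightarrow> bool" where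
  "v2_formula b q v \<longleftrightarrow> (\<forall>x t.
     v 2 1 x t = - \<i> * b * (q 1 x t + q 2 x t + q 3 x t) \<and>
     v 2 2 x t = - \<i> * b * q 2 x t \<and>
     v 2 3 x t = - \<i> * b * (q 1 x t - q 2 x t - q 3 x t))"

definition v1_formula ::
  "complex \<Rightarrow> (nat \<Rightarrow> complex field2) \<Rightarrow> complex field2 \<Rightarrow> (nat \<Rightarrow> nat \<Rightarrow> complex field2) \<Rightarrow> bool" where
  "v1_formula b q f v \<longleftrightarrow> (\<forall>x t.
     v 1 1 x t = 2 * b * (q 1 x t * q 2 x t - Dx (q 1) x t) + f x t \<and>
     v 1 2 x t = b * ((q 3 x t)^2 - (q 1 x t)^2 + q 1 x t * q 2 x t + q 2 x t * q 3 x t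
                      + Dx (\<lambda>x t. q 3 x t + q 2 x t - q 1 x t) x t) + f x t \<and>
     v 1 3 x t = b * ((q 3 x t)^2 - (q 2 x t)^2 - (q 1 x t)^2 + q 1 x t * q 2 x t
                      + Dx (\<lambda>x t. q 3 x t + 2 * q 2 x t - q 1 x t) x t) + f x t \<and>
     v 1 4 x t = f x t)"

definition f_mkdv :: "complex \<Rightarrow> (nat \<Rightarrow> complex field2) \<Rightarrow> complex field2" where
  "f_mkdv b q = (\<lambda>x t. b / 5 *
     (2 * (q 2 x t)^2 + 2 * (q 1 x t)^2 - 3 * (q 3 x t)^2 - 5 * q 1 x t * q 2 x t
      + Dx (\<lambda>x t. 5 * q 1 x t - 4 * q 2 x t - 3 * q 3 x t) x t))"

definition F1 :: "(nat \<Rightarrow> complex field2) \<Rightarrow> complex field2" where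
  "F1 q = (\<lambda>x t.
     - 5 * Dx (Dx (q 1)) x t + 3 * q 1 x t * Dx (\<lambda>x t. 3 * q 2 x t + q 3 x t) x t
     - 2 * (q 1 x t)^3 + 3 * q 1 x t * ((q 2 x t)^2 + (q 3 x t)^2))"

definition F2 :: "(nat \<Rightarrow> complex field2) \<Rightarrow> complex field2" where
  "F2 q = (\<lambda>x t.
     Dx (Dx (\<lambda>x t. 4 * q 2 x t + 3 * q 3 x t)) x t + 3 * q 2 x t * Dx (q 3) x t
     - 9 * q 1 x t * Dx (q 1) x t + 6 * q 3 x t * Dx (q 3) x t
     - 2 * (q 2 x t)^3 + 3 * q 2 x t * ((q 1 x t)^2 + (q 3 x t)^2))"

definition F3 :: "(nat \<Rightarrow> complex field2) \<Rightarrow> complex field2" where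
  "F3 q = (\<lambda>x t.
     Dx (Dx (\<lambda>x t. q 3 x t + 3 * q 2 x t)) x t - 6 * q 3 x t * Dx (q 2) x t
     - 3 * q 1 x t * Dx (q 1) x t - 3 * q 2 x t * Dx (q 2) x t
     - 2 * (q 3 x t)^3 + 3 * q 3 x t * ((q 1 x t)^2 + (q 2 x t)^2))"

definition Fj :: "(nat \<Rightarrow> complex field2) \<Rightarrow> nat \<Rightarrow> complex field2" where
  "Fj q j = (if j = 1 then F1 q else if j = 2 then F2 q else F3 q)"

definition v0_formula ::
  "complex \<Rightarrow> (nat \<Rightarrow> complex field2) \<Rightarrow> (nat \<Rightarrow> nat \<Rightarrow> complex field2) \<Rightarrow> bool" where
  "v0_formula b q v \<longleftrightarrow> (\<forall>j\<in>{1..3}. \<forall>x t. v 0 j x t = \<i> * b / 5 * Fj q j x t)"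

definition mkdv :: "complex \<Rightarrow> (nat \<Rightarrow> complex field2) \<Rightarrow> bool" where
  "mkdv \<alpha> q \<longleftrightarrow> (\<forall>j\<in>{1..3}. \<forall>x t. \<alpha> * Dt (q j) x t = Dx (Fj q j) x t)"

text \<open>The recurrences determine f only up to an integration constant c(t): adding c J to \<open>V\<^bsup>(1)\<^esup>\<close> and
  -c Q to \<open>V\<^bsup>(0)\<^esup>\<close> respects them and adds the translation flow to the system. The two
  definitions below are the forms with c; c = 0 gives \<^const>\<open>v0_formula\<close> and \<^const>\<open>mkdv\<close>.\<close>

definition v0_formula_const ::
  "complex \<Rightarrow> (nat \<Rightarrow> complex field2) \<Rightarrow> (real \<Rightarrow> complex) \<Rightarrow> (nat \<Rightarrow> nat \<Rightarrow> complex field2) \<Rightarrow> bool" where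
  "v0_formula_const b q c v \<longleftrightarrow>
     (\<forall>j\<in>{1..3}. \<forall>x t. v 0 j x t = \<i> * b / 5 * Fj q j x t - \<i> * c t * q j x t)"

definition mkdv_const ::
  "complex \<Rightarrow> (nat \<Rightarrow> complex field2) \<Rightarrow> (real \<Rightarrow> complex) \<Rightarrow> bool" where
  "mkdv_const \<alpha> q c \<longleftrightarrow>
     (\<forall>j\<in>{1..3}. \<forall>x t. \<alpha> * Dt (q j) x t = Dx (Fj q j) x t - \<alpha> * c t * Dx (q j) x t)"

text \<open>Vanishing boundary conditions at minus infinity, which make the integration constant zero.\<close>

definition vanishing_bc ::
  "(nat \<Rightarrow> complex field2) \<Rightarrow> complex field2 \<Rightarrow> bool" where
  "vanishing_bc q f \<longleftrightarrow> (\<forall>t.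
     (\<forall>j\<in>{1..3}. ((\<lambda>x. q j x t) \<longlongrightarrow> 0) at_bot \<and> ((\<lambda>x. Dx (q j) x t) \<longlongrightarrow> 0) at_bot) \<and>
     ((\<lambda>x. f x t) \<longlongrightarrow> 0) at_bot)"

end

theory Submission
  imports Defs
begin

text \<open>Equality of mixed partial derivatives turns [L,M] into multiplication by a matrix polynomial in the
  spectral parameter, so [L,M] = 0 means that its coefficients vanish. In entries these are scalar
  equations. Measuring each \<open>v\<^sub>j\<^bsup>(k)\<^esup>\<close> by its deviation from the claimed formula turns the equations
  into homogeneous linear ones with constant coefficients; for k = 1 there is one equation more than
  unknowns, and it says that f differs from its formula by a function with zero x-derivative.\<close>

section \<open>Smooth fields and the commutator of two first-order operators\<close>

text \<open>The pattern of determined and free data comes from the commutator with J. Each relation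
  determines the next matrix V^(k) through [J, V^(k)], hence only up to matrices of its shape
  commuting with J, and it can be solved only if the remaining terms have trace zero against every
  power of J. No nonzero matrix of the shape of V^(2) or V^(0) commutes with J, whereas among those
  of the shape of V^(1) exactly the multiples of J do: hence the free f. The condition on f is the
  trace of the next relation against J^4, which removes [J, V^(0)]. Here J^6 = J, the eigenvalues of
  J are 0 and the fifth roots of unity, and the term f J contributes tr(J^5) = 5 times the
  derivative of f; this is the 5 in the formulas for f, \<open>v 0 j\<close> and \<alpha>. The
  obstacle is that only the derivative of f is fixed, so that an exact equivalence has to carry c(t)
  along or to normalise f.\<close>

lemma smooth_Dx: "smooth u \<Longrightarrow> smooth (Dx u)"
  by (metis Ck.simps(2) smooth_def)

lemma smooth_Dt: "smooth u \<Longrightarrow> smooth (Dt u)"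
  by (metis Ck.simps(2) smooth_def)

lemma smooth_has_Dx:
  assumes "smooth u"
  shows "((\<lambda>y. u y t) has_vector_derivative Dx u x t) (at x)"
proof -
  have "Ck (Suc 0) u" using assms smooth_def by blast
  then show ?thesis by (simp add: Dx_def flip: vector_derivative_works)
qed

lemma smooth_has_Dt:
  assumes "smooth u"
  shows "((\<lambda>s. u x s) has_vector_derivative Dt u x t) (at t)"
proof -
  have "Ck (Suc 0) u" using assms smooth_def by blast
  then show ?thesis by (simp add: Dt_def flip: vector_derivative_works)
qed

lemma smooth_continuous: "smooth u \<Longrightarrow> continuous_on UNIV (\<lambda>(x, t). u x t)"
  by (metis Ck.simps(1) smooth_def)

lemma Dx_eqI: "((\<lambda>y. u y t) has_vector_derivative d) (at x) \<Longrightarrow> Dx u x t = d"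
  by (simp add: Dx_def vector_derivative_at)

lemma Dt_eqI: "((\<lambda>s. u x s) has_vector_derivative d) (at t) \<Longrightarrow> Dt u x t = d"
  by (simp add: Dt_def vector_derivative_at)

lemma Dx_const: "Dx (\<lambda>x t. c t) = (\<lambda>x t. 0)"
  by (intro ext Dx_eqI) (auto intro: derivative_eq_intros)

lemma Dt_const: "Dt (\<lambda>x t. c x) = (\<lambda>x t. 0)"
  by (intro ext Dt_eqI) (auto intro: derivative_eq_intros)

lemma smooth_const: "smooth (\<lambda>x t. w)"
proof -
  have "Ck n (\<lambda>x t. w)" for n and w :: 'a
    by (induction n arbitrary: w) (simp_all add: Dx_const Dt_const)
  then show ?thesis by (simp add: smooth_def)
qed

lemma smooth_slice:
  assumes "smooth u" shows "continuous_on S (\<lambda>y. u y t)"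
  using continuous_on_compose2[OF smooth_continuous[OF assms], of S "\<lambda>y. (y, t)"]
  by (simp add: continuous_intros)

text \<open>Differentiate \<open>u y t = u a t + \<integral>\<^sub>a\<^sup>y Dx u\<close> first in t under the integral sign, then in y.\<close>

lemma Dx_Dt_commute:
  fixes u :: "'a::banach field2"
  assumes u: "smooth u"
  shows "Dx (Dt u) x t = Dt (Dx u) x t"
proof (rule Dx_eqI)
  \<comment> \<open>The base point lies strictly left of x, so x is interior to
    \<open>{a..x + 1}\<close> and a derivative within this interval is a two-sided one.\<close>
  define a where "a = x - 1"
  have ux: "smooth (Dx u)" and uxt: "smooth (Dt (Dx u))"
    using u smooth_Dx smooth_Dt by blast+
  have ftc: "u y s = u a s + integral {a..y} (\<lambda>z. Dx u z s)" if "a \<le> y" for y s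
  proof -
    have "((\<lambda>z. Dx u z s) has_integral u y s - u a s) {a..y}"
      using that by (intro fundamental_theorem_of_calculus)
        (auto intro: has_vector_derivative_at_within smooth_has_Dx[OF u])
    then show ?thesis by (simp add: integral_unique)
  qed
  have Dt_u: "Dt u y t = Dt u a t + integral {a..y} (\<lambda>z. Dt (Dx u) z t)" if y: "a \<le> y" for y
  proof (rule Dt_eqI)
    have cont: "continuous_on (UNIV \<times> cbox a y) (\<lambda>(s, z). Dt (Dx u) z s)"
      using continuous_on_compose2[OF smooth_continuous[OF uxt], of "UNIV \<times> cbox a y" "\<lambda>p. (snd p, fst p)"]
      by (simp add: continuous_intros split_beta)
    have "((\<lambda>s. integral (cbox a y) (\<lambda>z. Dx u z s)) has_vector_derivative
        integral (cbox a y) (\<lambda>z. Dt (Dx u) z t)) (at t within UNIV)"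
      using cont by (intro leibniz_rule_vector_derivative)
        (auto intro: smooth_has_Dt[OF ux] integrable_continuous_interval smooth_slice[OF ux])
    then have "((\<lambda>s. u a s + integral {a..y} (\<lambda>z. Dx u z s)) has_vector_derivative
        Dt u a t + integral {a..y} (\<lambda>z. Dt (Dx u) z t)) (at t)"
      by (intro has_vector_derivative_add smooth_has_Dt[OF u]) simp
    then show "((\<lambda>s. u y s) has_vector_derivative
        Dt u a t + integral {a..y} (\<lambda>z. Dt (Dx u) z t)) (at t)"
      by (simp only: ftc[OF y, symmetric])
  qed
  have "((\<lambda>y. integral {a..y} (\<lambda>z. Dt (Dx u) z t)) has_vector_derivative Dt (Dx u) x t)
      (at x within {a..x + 1})"
    by (intro integral_has_vector_derivative smooth_slice[OF uxt]) (simp add: a_def)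
  then have "((\<lambda>y. Dt u a t + integral {a..y} (\<lambda>z. Dt (Dx u) z t)) has_vector_derivative
      Dt (Dx u) x t) (at x within {a..x + 1})"
    by (auto intro: derivative_eq_intros)
  \<comment> \<open>\<open>Dt_u\<close> is available only for \<open>a \<le> y\<close>, so the
    exchange of functions takes place within the interval, not on the whole line.\<close>
  then have "((\<lambda>y. Dt u y t) has_vector_derivative Dt (Dx u) x t) (at x within {a..x + 1})"
    by (rule has_vector_derivative_transform[rotated 2]) (simp add: a_def, rule Dt_u, simp)
  then show "((\<lambda>y. Dt u y t) has_vector_derivative Dt (Dx u) x t) (at x)"
    by (simp add: a_def at_within_Icc_at)
qed

section \<open>Matrix operations as bounded linear maps, and the commutator of matrix
  operators\<close>

lemma bounded_linear_smult_mat6_left: "bounded_linear (\<lambda>c. c *\<^sub>M A)"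
  unfolding linear_conv_bounded_linear[symmetric]
  by (rule linearI) (simp_all add: smult_mat6_def vec_eq_iff algebra_simps)

lemma bounded_linear_smult_mat6_right: "bounded_linear (\<lambda>A. c *\<^sub>M A)"
  unfolding linear_conv_bounded_linear[symmetric]
  by (rule linearI) (simp_all add: smult_mat6_def vec_eq_iff algebra_simps)

lemma bounded_linear_vec_smult: "bounded_linear (\<lambda>w. c *s (w :: vec6))"
  unfolding linear_conv_bounded_linear[symmetric]
  by (rule linearI) (simp_all add: vec_eq_iff algebra_simps)

lemma bounded_bilinear_mat6_vec: "bounded_bilinear (\<lambda>(A :: mat6) w. A *v w)"
  unfolding bilinear_conv_bounded_bilinear[symmetric] bilinear_def
  by (auto intro!: linearI simp: vec_eq_iff matrix_vector_mult_def algebra_simps sum.distrib scaleR_sum_right)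

lemmas smult_mat6_vector_derivative =
  bounded_linear.has_vector_derivative[OF bounded_linear_smult_mat6_left]
  bounded_linear.has_vector_derivative[OF bounded_linear_smult_mat6_right]

lemma smult_mat6_vec: "(c *\<^sub>M A) *v w = c *s (A *v w)"
  by (simp add: smult_mat6_def matrix_vector_mult_def vec_eq_iff sum_distrib_left mult.assoc)

text \<open>The second-order terms cancel by equality of mixed derivatives. The terms with B acting
  on \<open>Dx \<psi>\<close> and with A acting on \<open>Dt \<psi>\<close> occur in both products
  with the same factor and cancel too, so no derivative of \<psi> survives.\<close>

lemma op_comm_matrix:
  fixes A B A' B' :: "mat6 field2"
  assumes \<psi>: "smooth \<psi>"
    and A: "\<And>x t. ((\<lambda>s. A x s) has_vector_derivative A' x t) (at t)"
    and B: "\<And>x t. ((\<lambda>y. B y t) has_vector_derivative B' x t) (at x)"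
  shows "op_comm (\<lambda>\<phi> x t. \<i> *s Dx \<phi> x t + A x t *v \<phi> x t) (\<lambda>\<phi> x t. \<i> *s Dt \<phi> x t + B x t *v \<phi> x t) \<psi> x t
    = (\<i> *\<^sub>M B' x t - \<i> *\<^sub>M A' x t + mcomm (A x t) (B x t)) *v \<psi> x t"
proof -
  note rules = bounded_linear.has_vector_derivative[OF bounded_linear_vec_smult]
    bounded_bilinear.has_vector_derivative[OF bounded_bilinear_mat6_vec]
  have dx: "Dx (\<lambda>x t. \<i> *s Dt \<psi> x t + B x t *v \<psi> x t) x t
      = \<i> *s Dt (Dx \<psi>) x t + (B x t *v Dx \<psi> x t + B' x t *v \<psi> x t)"
    by (subst Dx_Dt_commute[OF \<psi>, symmetric], rule Dx_eqI)
      (intro has_vector_derivative_add rules smooth_has_Dx \<psi> smooth_Dt B)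
  have dt: "Dt (\<lambda>x t. \<i> *s Dx \<psi> x t + A x t *v \<psi> x t) x t
      = \<i> *s Dt (Dx \<psi>) x t + (A x t *v Dt \<psi> x t + A' x t *v \<psi> x t)"
    by (rule Dt_eqI)
      (intro has_vector_derivative_add rules smooth_has_Dt \<psi> smooth_Dx A)
  show ?thesis
    unfolding op_comm_def dx dt mcomm_def
    by (simp add: matrix_vector_mult_add_rdistrib matrix_vector_mult_diff_rdistrib
      matrix_vector_right_distrib smult_mat6_vec vec.scale_right_distrib vec.scale vector_scalar_commute matrix_vector_mul_assoc)
qed

section \<open>Matrix entries\<close>

text \<open>With natural labels, conditions such as \<open>i = j + 1\<close> and reflections such as
  \<open>7 - j\<close> are decided on numerals. In the index type itself, arithmetic is modulo
  6.\<close>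

definition entry :: "mat6 \<Rightarrow> nat \<Rightarrow> nat \<Rightarrow> complex" where
  "entry A i j = A $ of_nat i $ of_nat j"

lemma labels_6: "{1..6::nat} = {1, 2, 3, 4, 5, 6}"
  by (auto simp: numeral_eq_Suc le_Suc_eq)

lemma bij_labels: "bij_betw (of_nat :: nat \<Rightarrow> 6) {1..6} UNIV"
proof -
  have inj: "inj_on (of_nat :: nat \<Rightarrow> 6) {1..6}"
    unfolding labels_6 by simp
  then have "card ((of_nat :: nat \<Rightarrow> 6) ` {1..6}) = CARD(6)"
    by (simp add: card_image)
  then have "(of_nat :: nat \<Rightarrow> 6) ` {1..6} = UNIV"
    by (intro card_eq_UNIV_imp_eq_UNIV) simp_all
  with inj show ?thesis by (simp add: bij_betw_def)
qed

lemma mat6_eq_iff: "A = B \<longleftrightarrow> (\<forall>i\<in>{1..6}. \<forall>j\<in>{1..6}. entry A i j = entry B i j)"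
proof -
  have all: "(\<forall>a :: 6. P a) \<longleftrightarrow> (\<forall>i\<in>{1..6}. P (of_nat i))" for P
    using bij_labels by (metis UNIV_I bij_betw_imp_surj_on imageE)
  show ?thesis by (simp only: vec_eq_iff all entry_def)
qed

lemma entry_mult: "entry (A ** B) i j = (\<Sum>k = 1..6. entry A i k * entry B k j)"
  by (simp only: entry_def matrix_matrix_mult_def vec_lambda_beta
    sum.reindex_bij_betw[OF bij_labels, of "\<lambda>a. A $ of_nat i $ a * B $ a $ of_nat j", symmetric])

lemma entry_E:
  assumes "i \<in> {1..6}" "j \<in> {1..6}" "k \<in> {1..6}" "l \<in> {1..6}"
  shows "entry (E i j) k l = (if k = i \<and> l = j then 1 else 0)"
  using bij_labels assms by (auto simp: E_def entry_def bij_betw_def inj_on_eq_iff)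

lemma entry_arith:
  "entry 0 i j = 0"
  "entry (A + B) i j = entry A i j + entry B i j"
  "entry (A - B) i j = entry A i j - entry B i j"
  "entry (- A) i j = - entry A i j"
  "entry (c *\<^sub>M A) i j = c * entry A i j"
  by (simp_all add: entry_def smult_mat6_def)

lemma entry_mcomm: "entry (mcomm A B) i j =
    (\<Sum>k = 1..6. entry A i k * entry B k j) - (\<Sum>k = 1..6. entry B i k * entry A k j)"
  by (simp only: mcomm_def entry_arith entry_mult)

lemma sum_1_3: "(\<Sum>j = 1..3. f j) = f 1 + f 2 + f (3 :: nat)"
  by (simp add: numeral_eq_Suc add.assoc)

lemma sum_1_6: "(\<Sum>j = 1..6. f j) = f 1 + f 2 + f 3 + f 4 + f 5 + f (6 :: nat)"
  by (simp add: numeral_eq_Suc add.assoc)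

lemma all_1_6: "(\<forall>i\<in>{1..6}. P i) \<longleftrightarrow> P 1 \<and> P 2 \<and> P 3 \<and> P 4 \<and> P 5 \<and> P (6 :: nat)"
  unfolding labels_6 by simp

lemmas entry_basis = Ep_def Em_def entry_arith entry_E

text \<open>The reflection (i, j) -> (7 - j, 7 - i) fixes (4, 3), so \<open>Ep 4 3\<close> is twice
  a matrix unit and its factor 1/2 disappears. It sends (1, 5) to (2, 6), so there the factor
  stays.\<close>

lemma entry_Jmat:
  assumes "i \<in> {1..6}" "j \<in> {1..6}"
  shows "entry Jmat i j = (if i = j + 1 then 1 else if j = i + 4 then 1 / 2 else 0)"
proof -
  have "\<forall>i\<in>{1..6}. \<forall>j\<in>{1..6}. entry Jmat i j = (if i = j + 1 then 1 else if j = i + 4 then 1 / 2 else 0)"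
    unfolding all_1_6 by (simp add: Jmat_def entry_basis del: One_nat_def)
  with assms show ?thesis by blast
qed

text \<open>The index \<open>6 - j\<close> is the reflection again: it maps the subdiagonal position
  (j + 1, j) to (7 - j, 6 - j).\<close>

lemma entry_V1mat:
  assumes "i \<in> {1..6}" "j \<in> {1..6}"
  shows "entry (V1mat v x t) i j =
    (if i = j + 1 then v 1 (if j \<le> 3 then j else 6 - j) x t
     else if j = i + 4 then 1 / 2 * v 1 4 x t else 0)"
proof -
  have "\<forall>i\<in>{1..6}. \<forall>j\<in>{1..6}. entry (V1mat v x t) i j =
    (if i = j + 1 then v 1 (if j \<le> 3 then j else 6 - j) x t
     else if j = i + 4 then 1 / 2 * v 1 4 x t else 0)"
    unfolding all_1_6 by (simp add: V1mat_def entry_basis del: One_nat_def) simp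
  with assms show ?thesis by blast
qed

lemma entry_diagonal:
  assumes "i \<in> {1..6}" "j \<in> {1..6}"
  shows "entry (\<Sum>k = 1..3. d k *\<^sub>M Ep k k) i j =
    (if i = j then if i \<le> 3 then d i else - d (7 - i) else 0)"
proof -
  have "\<forall>i\<in>{1..6}. \<forall>j\<in>{1..6}. entry (\<Sum>k = 1..3. d k *\<^sub>M Ep k k) i j =
    (if i = j then if i \<le> 3 then d i else - d (7 - i) else 0)"
    unfolding all_1_6 sum_1_3 by (simp add: entry_basis del: One_nat_def) simp
  with assms show ?thesis by blast
qed

lemma entry_V2mat:
  assumes "i \<in> {1..6}" "j \<in> {1..6}"
  shows "entry (V2mat v x t) i j =
    (if i = j + 2 then if j = 1 then - v 2 1 x t else if j = 2 then - v 2 2 x t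
        else if j = 3 then v 2 2 x t else v 2 1 x t
     else if i = 1 \<and> j = 4 then - (1 / 2 * v 2 3 x t)
     else if i = 3 \<and> j = 6 then 1 / 2 * v 2 3 x t else 0)"
proof -
  have "\<forall>i\<in>{1..6}. \<forall>j\<in>{1..6}. entry (V2mat v x t) i j =
    (if i = j + 2 then if j = 1 then - v 2 1 x t else if j = 2 then - v 2 2 x t
        else if j = 3 then v 2 2 x t else v 2 1 x t
     else if i = 1 \<and> j = 4 then - (1 / 2 * v 2 3 x t)
     else if i = 3 \<and> j = 6 then 1 / 2 * v 2 3 x t else 0)"
    unfolding all_1_6 by (simp add: V2mat_def entry_basis del: One_nat_def)
  with assms show ?thesis by blast
qed

text \<open>An entry sums over three-step paths. Two paths of weight 1/2 lead to (2, 4) and to (3,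
  5), only one to (1, 3) and to (4, 6).\<close>

lemma entry_Jmat3:
  assumes "i \<in> {1..6}" "j \<in> {1..6}"
  shows "entry (Jmat ** Jmat ** Jmat) i j =
    (if i = j + 3 then 1 else if j = i + 2 then if i = 1 \<or> i = 4 then 1 / 2 else 1 else 0)"
proof -
  have "\<forall>i\<in>{1..6}. \<forall>j\<in>{1..6}. entry (Jmat ** Jmat ** Jmat) i j =
    (if i = j + 3 then 1 else if j = i + 2 then if i = 1 \<or> i = 4 then 1 / 2 else 1 else 0)"
    unfolding all_1_6 entry_mult sum_1_6 by (simp add: entry_Jmat del: One_nat_def)
  with assms show ?thesis by blast
qed

section \<open>The coefficients of the commutator\<close>

text \<open>The derivative is again a matrix of the same shape, built from the derivatives of the
  fields, so the entry tables apply to it as well. A general curve \<open>(X s, T s)\<close> covers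
  differentiation in x and in t at once.\<close>

lemma Qmat_has_vector_derivative:
  assumes "\<And>j. j \<in> {1..3} \<Longrightarrow> ((\<lambda>s. q j (X s) (T s)) has_vector_derivative q' j x t) (at s)"
  shows "((\<lambda>s. Qmat q (X s) (T s)) has_vector_derivative Qmat q' x t) (at s)"
  unfolding Qmat_def
  by (intro smult_mat6_vector_derivative has_vector_derivative_sum assms)

lemma V0mat_has_vector_derivative:
  assumes "\<And>j. j \<in> {1..3} \<Longrightarrow> ((\<lambda>s. v 0 j (X s) (T s)) has_vector_derivative v' 0 j x t) (at s)"
  shows "((\<lambda>s. V0mat v (X s) (T s)) has_vector_derivative V0mat v' x t) (at s)"
  unfolding V0mat_def
  by (intro smult_mat6_vector_derivative has_vector_derivative_sum assms)

lemma V1mat_has_vector_derivative: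
  assumes "\<And>j. j \<in> {1..4} \<Longrightarrow> ((\<lambda>s. v 1 j (X s) (T s)) has_vector_derivative v' 1 j x t) (at s)"
  shows "((\<lambda>s. V1mat v (X s) (T s)) has_vector_derivative V1mat v' x t) (at s)"
  unfolding V1mat_def
  by (intro smult_mat6_vector_derivative has_vector_derivative_add
    bounded_linear.has_vector_derivative[OF bounded_linear_mult_right] assms) auto

lemma V2mat_has_vector_derivative:
  assumes "\<And>j. j \<in> {1..3} \<Longrightarrow> ((\<lambda>s. v 2 j (X s) (T s)) has_vector_derivative v' 2 j x t) (at s)"
  shows "((\<lambda>s. V2mat v (X s) (T s)) has_vector_derivative V2mat v' x t) (at s)"
  unfolding V2mat_def
  by (intro smult_mat6_vector_derivative has_vector_derivative_diff has_vector_derivative_minus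
    bounded_linear.has_vector_derivative[OF bounded_linear_mult_right] assms) auto

lemma mcomm_arith:
  "mcomm A (B + C) = mcomm A B + mcomm A C"
  "mcomm A (B - C) = mcomm A B - mcomm A C"
  "mcomm (A - B) C = mcomm A C - mcomm B C"
  "mcomm (c *\<^sub>M A) B = c *\<^sub>M mcomm A B"
  "mcomm A (c *\<^sub>M B) = c *\<^sub>M mcomm A B"
  by (simp_all add: mcomm_def vec_eq_iff matrix_matrix_mult_def smult_mat6_def sum.distrib
    sum_subtractf sum_distrib_left algebra_simps)

text \<open>J and K are constant, so they contribute no derivatives; sorting the remaining terms by
  powers of \<zeta> gives \<open>lax_coeff\<close>.\<close>

lemma op_comm_lax:
  assumes q: "\<And>j. j \<in> {1..3} \<Longrightarrow> smooth (q j)"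
    and v0: "\<And>j. j \<in> {1..3} \<Longrightarrow> smooth (v 0 j)"
    and v1: "\<And>j. j \<in> {1..4} \<Longrightarrow> smooth (v 1 j)"
    and v2: "\<And>j. j \<in> {1..3} \<Longrightarrow> smooth (v 2 j)"
    and \<psi>: "smooth \<psi>"
  shows "op_comm (lax_L q \<zeta>) (lax_M b v \<zeta>) \<psi> x t
    = (\<Sum>k\<le>4. \<zeta>^k *\<^sub>M lax_coeff b q v k x t) *v \<psi> x t"
proof -
  let ?v' = "\<lambda>k j. Dx (v k j)"
  have V0: "((\<lambda>y. V0mat v y t) has_vector_derivative V0mat ?v' x t) (at x)" for x t
    by (intro V0mat_has_vector_derivative smooth_has_Dx v0)
  have V1: "((\<lambda>y. V1mat v y t) has_vector_derivative V1mat ?v' x t) (at x)" for x t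
    by (intro V1mat_has_vector_derivative smooth_has_Dx v1)
  have V2: "((\<lambda>y. V2mat v y t) has_vector_derivative V2mat ?v' x t) (at x)" for x t
    by (intro V2mat_has_vector_derivative smooth_has_Dx v2)
  have Q: "((\<lambda>s. Qmat q x s) has_vector_derivative Qmat (\<lambda>j. Dt (q j)) x t) (at t)" for x t
    by (intro Qmat_has_vector_derivative smooth_has_Dt q)
  let ?A = "\<lambda>x t. Qmat q x t - \<zeta> *\<^sub>M Jmat"
  let ?B = "\<lambda>x t. V0mat v x t + \<zeta> *\<^sub>M V1mat v x t + \<zeta>^2 *\<^sub>M V2mat v x t - \<zeta>^3 *\<^sub>M Kmat b"
  have A': "((\<lambda>s. ?A x s) has_vector_derivative Qmat (\<lambda>j. Dt (q j)) x t - 0) (at t)" for x t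
    by (intro has_vector_derivative_diff has_vector_derivative_const Q)
  have B': "((\<lambda>y. ?B y t) has_vector_derivative
      V0mat ?v' x t + \<zeta> *\<^sub>M V1mat ?v' x t + \<zeta>^2 *\<^sub>M V2mat ?v' x t - 0) (at x)" for x t
    by (intro has_vector_derivative_diff has_vector_derivative_add has_vector_derivative_const
      smult_mat6_vector_derivative V0 V1 V2)
  have "\<i> *\<^sub>M (V0mat ?v' x t + \<zeta> *\<^sub>M V1mat ?v' x t + \<zeta>^2 *\<^sub>M V2mat ?v' x t - 0)
      - \<i> *\<^sub>M (Qmat (\<lambda>j. Dt (q j)) x t - 0) + mcomm (?A x t) (?B x t)
    = (\<Sum>k\<le>4. \<zeta>^k *\<^sub>M lax_coeff b q v k x t)"
    unfolding lax_coeff_def Dx_eqI[OF V0] Dx_eqI[OF V1] Dx_eqI[OF V2] Dt_eqI[OF Q] mcomm_arith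
    by (simp add: numeral_eq_Suc vec_eq_iff smult_mat6_def algebra_simps)
  then show ?thesis
    using op_comm_matrix[OF \<psi> A' B', where x = x and t = t] by (simp add: lax_L_def[abs_def] lax_M_def[abs_def])
qed

text \<open>A matrix that annihilates every vector is zero, and each of its entries is a complex
  polynomial in \<zeta> that vanishes everywhere.\<close>

lemma matrix_polynomial_eq_0_iff:
  "(\<forall>\<zeta> w. (\<Sum>k\<le>n. \<zeta>^k *\<^sub>M C k) *v w = 0) \<longleftrightarrow> (\<forall>k\<le>n. C k = 0)"
proof
  assume "\<forall>\<zeta> w. (\<Sum>k\<le>n. \<zeta>^k *\<^sub>M C k) *v w = 0"
  then have "(\<Sum>k\<le>n. \<zeta>^k *\<^sub>M C k) = 0" for \<zeta>
    by (simp add: matrix_eq)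
  then have "(\<Sum>k\<le>n. C k $ i $ j * \<zeta>^k) = 0" for \<zeta> i j
    by (simp add: vec_eq_iff smult_mat6_def mult.commute)
  then have "\<forall>k\<le>n. C k $ i $ j = 0" for i j
    by (intro iffD1[OF polyfun_eq_0] allI)
  then show "\<forall>k\<le>n. C k = 0"
    by (simp add: vec_eq_iff)
next
  assume "\<forall>k\<le>n. C k = 0"
  then have "(\<Sum>k\<le>n. \<zeta>^k *\<^sub>M C k) = 0" for \<zeta>
    by (intro sum.neutral) (simp add: vec_eq_iff smult_mat6_def)
  then show "\<forall>\<zeta> w. (\<Sum>k\<le>n. \<zeta>^k *\<^sub>M C k) *v w = 0"
    by simp
qed

lemma lax_commute_iff:
  assumes "\<And>\<zeta> \<psi> x t. smooth \<psi> \<Longrightarrow>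
    op_comm (lax_L q \<zeta>) (lax_M b v \<zeta>) \<psi> x t
      = (\<Sum>k\<le>4. \<zeta>^k *\<^sub>M lax_coeff b q v k x t) *v \<psi> x t"
  shows "lax_commute b q v \<longleftrightarrow> (\<forall>k\<le>4. \<forall>x t. lax_coeff b q v k x t = 0)"
proof
  assume comm: "lax_commute b q v"
  \<comment> \<open>The commutator acts by multiplication, so constant fields already test it on
    every vector w.\<close>
  have "(\<Sum>k\<le>4. \<zeta>^k *\<^sub>M lax_coeff b q v k x t) *v w = 0" for \<zeta> w x t
    using comm assms[OF smooth_const[of w], of \<zeta> x t] smooth_const[of w]
    unfolding lax_commute_def by metis
  then have "\<forall>k\<le>4. lax_coeff b q v k x t = 0" for x t
    using matrix_polynomial_eq_0_iff[where n = 4 and C = "\<lambda>k. lax_coeff b q v k x t"] by blast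
  then show "\<forall>k\<le>4. \<forall>x t. lax_coeff b q v k x t = 0"
    by blast
next
  assume "\<forall>k\<le>4. \<forall>x t. lax_coeff b q v k x t = 0"
  then have "(\<Sum>k\<le>4. \<zeta>^k *\<^sub>M lax_coeff b q v k x t) *v w = 0" for \<zeta> w x t
    using matrix_polynomial_eq_0_iff[where n = 4 and C = "\<lambda>k. lax_coeff b q v k x t"] by blast
  then show "lax_commute b q v"
    unfolding lax_commute_def by (metis assms)
qed

section \<open>Vanishing of each coefficient as a system of scalar equations\<close>

lemma all_1_3: "(\<forall>j\<in>{1..3}. P j) \<longleftrightarrow> P 1 \<and> P 2 \<and> P (3 :: nat)"
proof -
  have "{1..3} = {1, 2, 3 :: nat}" by auto
  then show ?thesis by simp
qed

lemma entry_Qmat: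
  assumes "i \<in> {1..6}" "j \<in> {1..6}"
  shows "entry (Qmat q x t) i j =
    (if i = j then if i \<le> 3 then \<i> * q i x t else - (\<i> * q (7 - i) x t) else 0)"
  unfolding Qmat_def using assms entry_diagonal[of i j "\<lambda>j. q j x t"] by (simp add: entry_arith)

lemma entry_V0mat:
  assumes "i \<in> {1..6}" "j \<in> {1..6}"
  shows "entry (V0mat v x t) i j =
    (if i = j then if i \<le> 3 then v 0 i x t else - v 0 (7 - i) x t else 0)"
  unfolding V0mat_def using assms by (rule entry_diagonal)

lemmas entry_lax = entry_arith entry_mcomm sum_1_6 Kmat_def
  entry_Jmat entry_Jmat3 entry_Qmat entry_V0mat entry_V1mat entry_V2mat

text \<open>Separates computing the entries from solving. Entries in mirror positions (i, j) and (7
  - j, 7 - i) agree for odd powers of \<zeta> and are opposite for even ones, so a table in a few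
  abstract scalars describes the whole matrix.\<close>

lemma mat6_eq_0_iff_table:
  assumes "\<forall>i\<in>{1..6}. \<forall>j\<in>{1..6}. entry A i j = T i j"
  shows "A = 0 \<longleftrightarrow> (\<forall>i\<in>{1..6}. \<forall>j\<in>{1..6}. T i j = 0)"
  using assms by (simp add: mat6_eq_iff entry_arith)

text \<open>K is a multiple of a power of J, so it commutes with J.\<close>

lemma lax_coeff_4: "lax_coeff b q v 4 x t = 0"
  unfolding mat6_eq_iff all_1_6 lax_coeff_def
  by (simp add: entry_lax del: One_nat_def)

lemma lax_coeff_3_eq_0_iff: "lax_coeff b q v 3 x t = 0 \<longleftrightarrow>
    - (\<i> * b * (q 1 x t - q 3 x t)) - v 2 2 x t - v 2 3 x t = 0 \<and>
    - (2 * \<i> * b * (q 2 x t + q 3 x t)) - v 2 1 x t + v 2 3 x t = 0 \<and>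
    \<i> * b * (q 1 x t + q 3 x t) + v 2 1 x t - v 2 2 x t = 0 \<and>
    \<i> * b * q 2 x t + v 2 2 x t = 0"
  (is "_ \<longleftrightarrow> ?X1 = 0 \<and> ?X2 = 0 \<and> ?X3 = 0 \<and> ?X4 = 0")
proof -
  \<comment> \<open>The entry at (5, 2) carries the factor 2 because the reflection fixes this
    position; the other nonzero entries form mirror pairs.\<close>
  let ?T = "\<lambda>X1 X2 X3 X4 (i :: nat) (j :: nat). if j = i + 2 then (if i = 1 \<or> i = 4 then X1 / 2 else X2 / 2)
     else if i = j + 3 then if j = 2 then 2 * X4 else X3 else 0"
  have solved: "(\<forall>i\<in>{1..6}. \<forall>j\<in>{1..6}. ?T X1 X2 X3 X4 i j = 0) \<longleftrightarrow> X1 = 0 \<and> X2 = 0 \<and> X3 = 0 \<and> X4 = 0"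
    for X1 X2 X3 X4 :: complex
    unfolding all_1_6 by auto
  have "\<forall>i\<in>{1..6}. \<forall>j\<in>{1..6}. entry (lax_coeff b q v 3 x t) i j = ?T ?X1 ?X2 ?X3 ?X4 i j"
    unfolding all_1_6 lax_coeff_def
    by (simp add: entry_lax del: One_nat_def) (simp add: field_simps)
  then have "lax_coeff b q v 3 x t = 0 \<longleftrightarrow> (\<forall>i\<in>{1..6}. \<forall>j\<in>{1..6}. ?T ?X1 ?X2 ?X3 ?X4 i j = 0)"
    by (rule mat6_eq_0_iff_table)
  also have "\<dots> \<longleftrightarrow> ?X1 = 0 \<and> ?X2 = 0 \<and> ?X3 = 0 \<and> ?X4 = 0"
    by (rule solved)
  finally show ?thesis .
qed

lemma lax_coeff_2_eq_0_iff:
  assumes "\<forall>j\<in>{1..3}. smooth (v 2 j)"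
  shows "lax_coeff b q v 2 x t = 0 \<longleftrightarrow>
    - (\<i> * Dx (v 2 3) x t) - \<i> * (q 1 x t + q 3 x t) * v 2 3 x t - v 1 2 x t + v 1 4 x t = 0 \<and>
    - (\<i> * Dx (v 2 1) x t) + \<i> * (q 1 x t - q 3 x t) * v 2 1 x t - v 1 1 x t + v 1 2 x t = 0 \<and>
    - (\<i> * Dx (v 2 2) x t) + \<i> * (q 2 x t + q 3 x t) * v 2 2 x t - v 1 2 x t + v 1 3 x t = 0"
  (is "_ \<longleftrightarrow> ?X1 = 0 \<and> ?X2 = 0 \<and> ?X3 = 0")
proof -
  have D: "Dx (V2mat v) x t = V2mat (\<lambda>k j. Dx (v k j)) x t"
    by (intro Dx_eqI V2mat_has_vector_derivative smooth_has_Dx assms[rule_format])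
  let ?T = "\<lambda>X1 X2 X3 (i :: nat) (j :: nat). if i = 1 \<and> j = 4 then X1 / 2 else if i = 3 \<and> j = 6 then - (X1 / 2)
     else if i = j + 2 then if j = 1 then X2 else if j = 2 then X3
       else if j = 3 then - X3 else - X2 else 0"
  have solved: "(\<forall>i\<in>{1..6}. \<forall>j\<in>{1..6}. ?T X1 X2 X3 i j = 0) \<longleftrightarrow> X1 = 0 \<and> X2 = 0 \<and> X3 = 0"
    for X1 X2 X3 :: complex
    unfolding all_1_6 by auto
  have "\<forall>i\<in>{1..6}. \<forall>j\<in>{1..6}. entry (lax_coeff b q v 2 x t) i j = ?T ?X1 ?X2 ?X3 i j"
    unfolding all_1_6 lax_coeff_def D
    by (simp add: entry_lax del: One_nat_def) (simp add: field_simps)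
  then have "lax_coeff b q v 2 x t = 0 \<longleftrightarrow> (\<forall>i\<in>{1..6}. \<forall>j\<in>{1..6}. ?T ?X1 ?X2 ?X3 i j = 0)"
    by (rule mat6_eq_0_iff_table)
  also have "\<dots> \<longleftrightarrow> ?X1 = 0 \<and> ?X2 = 0 \<and> ?X3 = 0"
    by (rule solved)
  finally show ?thesis .
qed

lemma lax_coeff_1_eq_0_iff:
  assumes "\<forall>j\<in>{1..4}. smooth (v 1 j)"
  shows "lax_coeff b q v 1 x t = 0 \<longleftrightarrow>
    \<i> * Dx (v 1 4) x t + \<i> * (q 1 x t + q 2 x t) * v 1 4 x t + v 0 1 x t + v 0 2 x t = 0 \<and>
    \<i> * Dx (v 1 1) x t - \<i> * (q 1 x t - q 2 x t) * v 1 1 x t - v 0 1 x t + v 0 2 x t = 0 \<and>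
    \<i> * Dx (v 1 2) x t - \<i> * (q 2 x t - q 3 x t) * v 1 2 x t - v 0 2 x t + v 0 3 x t = 0 \<and>
    \<i> * Dx (v 1 3) x t - 2 * \<i> * q 3 x t * v 1 3 x t - 2 * v 0 3 x t = 0"
  (is "_ \<longleftrightarrow> ?X1 = 0 \<and> ?X2 = 0 \<and> ?X3 = 0 \<and> ?X4 = 0")
proof -
  have D: "Dx (V1mat v) x t = V1mat (\<lambda>k j. Dx (v k j)) x t"
    by (intro Dx_eqI V1mat_has_vector_derivative smooth_has_Dx assms[rule_format])
  let ?T = "\<lambda>X1 X2 X3 X4 (i :: nat) (j :: nat). if j = i + 4 then X1 / 2
     else if i = j + 1 then if j = 1 \<or> j = 5 then X2 else if j = 3 then X4 else X3 else 0"
  have solved: "(\<forall>i\<in>{1..6}. \<forall>j\<in>{1..6}. ?T X1 X2 X3 X4 i j = 0) \<longleftrightarrow> X1 = 0 \<and> X2 = 0 \<and> X3 = 0 \<and> X4 = 0"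
    for X1 X2 X3 X4 :: complex
    unfolding all_1_6 by auto
  have "\<forall>i\<in>{1..6}. \<forall>j\<in>{1..6}. entry (lax_coeff b q v 1 x t) i j = ?T ?X1 ?X2 ?X3 ?X4 i j"
    unfolding all_1_6 lax_coeff_def D
    by (simp add: entry_lax del: One_nat_def) (simp add: field_simps)
  then have "lax_coeff b q v 1 x t = 0 \<longleftrightarrow> (\<forall>i\<in>{1..6}. \<forall>j\<in>{1..6}. ?T ?X1 ?X2 ?X3 ?X4 i j = 0)"
    by (rule mat6_eq_0_iff_table)
  also have "\<dots> \<longleftrightarrow> ?X1 = 0 \<and> ?X2 = 0 \<and> ?X3 = 0 \<and> ?X4 = 0"
    by (rule solved)
  finally show ?thesis .
qed

text \<open>Q and V^(0) are diagonal, so their commutator drops out; the nonlinearity of the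
  evolution equations enters only through the formulas for \<open>v 0 j\<close>.\<close>

lemma lax_coeff_0_eq_0_iff:
  assumes "\<forall>j\<in>{1..3}. smooth (v 0 j)" "\<forall>j\<in>{1..3}. smooth (q j)"
  shows "lax_coeff b q v 0 x t = 0 \<longleftrightarrow>
    (\<forall>j\<in>{1..3}. \<i> * Dx (v 0 j) x t + Dt (q j) x t = 0)"
  (is "_ \<longleftrightarrow> (\<forall>j\<in>_. ?X j = 0)")
proof -
  have D: "Dx (V0mat v) x t = V0mat (\<lambda>k j. Dx (v k j)) x t"
    "Dt (Qmat q) x t = Qmat (\<lambda>j. Dt (q j)) x t"
    by (intro Dx_eqI V0mat_has_vector_derivative smooth_has_Dx
      Dt_eqI Qmat_has_vector_derivative smooth_has_Dt assms[rule_format]; assumption)+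
  let ?T = "\<lambda>X (i :: nat) (j :: nat). if i = j then if i \<le> 3 then X i else - X (7 - i) else 0"
  have solved: "(\<forall>i\<in>{1..6}. \<forall>j\<in>{1..6}. ?T X i j = 0) \<longleftrightarrow> (\<forall>j\<in>{1..3}. X j = 0)"
    for X :: "nat \<Rightarrow> complex"
    unfolding all_1_6 all_1_3 by auto
  have "\<forall>i\<in>{1..6}. \<forall>j\<in>{1..6}. entry (lax_coeff b q v 0 x t) i j = ?T ?X i j"
    unfolding all_1_6 lax_coeff_def D
    by (simp add: entry_lax del: One_nat_def)
  then have "lax_coeff b q v 0 x t = 0 \<longleftrightarrow> (\<forall>i\<in>{1..6}. \<forall>j\<in>{1..6}. ?T ?X i j = 0)"
    by (rule mat6_eq_0_iff_table)
  also have "\<dots> \<longleftrightarrow> (\<forall>j\<in>{1..3}. ?X j = 0)"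
    by (rule solved)
  finally show ?thesis .
qed

section \<open>Solving the recurrence\<close>

text \<open>Closed under sums and products by the one-variable rules alone, which spares the
  corresponding closure of \<open>smooth\<close> under all mixed derivatives.\<close>

definition x_diff :: "complex field2 \<Rightarrow> bool" where
  "x_diff u \<longleftrightarrow> (\<forall>x t. (\<lambda>y. u y t) differentiable at x)"

lemma x_diff_has_Dx: "x_diff u \<Longrightarrow> ((\<lambda>y. u y t) has_vector_derivative Dx u x t) (at x)"
  by (simp add: x_diff_def Dx_def flip: vector_derivative_works)

lemma x_diffI: "(\<And>x t. ((\<lambda>y. u y t) has_vector_derivative d x t) (at x)) \<Longrightarrow> x_diff u"
  by (auto simp: x_diff_def intro: differentiableI_vector)

lemma smooth_x_diff: "smooth u \<Longrightarrow> x_diff u"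
  by (rule x_diffI) (rule smooth_has_Dx)

text \<open>The rules for \<open>Dx\<close> are equations between functions, so that they also
  rewrite under a second \<open>Dx\<close>.\<close>

lemma
  assumes "x_diff u" "x_diff w"
  shows x_diff_add: "x_diff (\<lambda>x t. u x t + w x t)"
    and Dx_add: "Dx (\<lambda>x t. u x t + w x t) = (\<lambda>x t. Dx u x t + Dx w x t)"
    and x_diff_diff: "x_diff (\<lambda>x t. u x t - w x t)"
    and Dx_diff: "Dx (\<lambda>x t. u x t - w x t) = (\<lambda>x t. Dx u x t - Dx w x t)"
    and x_diff_mult: "x_diff (\<lambda>x t. u x t * w x t)"
    and Dx_mult: "Dx (\<lambda>x t. u x t * w x t) = (\<lambda>x t. u x t * Dx w x t + Dx u x t * w x t)"
proof -
  note u = assms[THEN x_diff_has_Dx]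
  note add = has_vector_derivative_add[OF u] and diff = has_vector_derivative_diff[OF u]
    and mult = has_vector_derivative_mult[OF u]
  show "x_diff (\<lambda>x t. u x t + w x t)" by (rule x_diffI) (rule add)
  show "Dx (\<lambda>x t. u x t + w x t) = (\<lambda>x t. Dx u x t + Dx w x t)" by (intro ext Dx_eqI add)
  show "x_diff (\<lambda>x t. u x t - w x t)" by (rule x_diffI) (rule diff)
  show "Dx (\<lambda>x t. u x t - w x t) = (\<lambda>x t. Dx u x t - Dx w x t)" by (intro ext Dx_eqI diff)
  show "x_diff (\<lambda>x t. u x t * w x t)" by (rule x_diffI) (rule mult)
  show "Dx (\<lambda>x t. u x t * w x t) = (\<lambda>x t. u x t * Dx w x t + Dx u x t * w x t)"
    by (intro ext Dx_eqI mult)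
qed

lemma x_diff_const: "x_diff (\<lambda>x t. c t)"
  by (simp add: x_diff_def)

lemma
  assumes "x_diff u"
  shows x_diff_uminus: "x_diff (\<lambda>x t. - u x t)"
    and Dx_uminus: "Dx (\<lambda>x t. - u x t) = (\<lambda>x t. - Dx u x t)"
  using x_diff_diff[OF x_diff_const assms, of "\<lambda>t. 0"] Dx_diff[OF x_diff_const assms, of "\<lambda>t. 0"]
  by (simp_all add: Dx_const)

lemmas Dx_rules = Dx_const Dx_add Dx_diff Dx_mult Dx_uminus
  x_diff_const x_diff_add x_diff_diff x_diff_mult x_diff_uminus power2_eq_square power3_eq_cube

lemma Dx_eq_0_imp_const:
  assumes "x_diff u" "\<And>x t. Dx u x t = 0"
  shows "u x t = u y t"
proof -
  have "((\<lambda>x. u x t) has_vector_derivative 0) (at x within UNIV)" for x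
    using x_diff_has_Dx[OF assms(1), of t x] assms(2) by simp
  then obtain c where "\<And>x. u x t = c"
    using has_vector_derivative_zero_constant[of UNIV "\<lambda>x. u x t"] by auto
  then show ?thesis by simp
qed

section \<open>The recurrence solved for V^(2), V^(1) and V^(0), and the evolution equations\<close>

lemma v2_formula_iff: "(\<forall>x t. lax_coeff b q v 3 x t = 0) \<longleftrightarrow> v2_formula b q v"
proof -
  have "- (\<i> * b * (q1 - q3)) - u2 - u3 = 0 \<and> - (2 * \<i> * b * (q2 + q3)) - u1 + u3 = 0 \<and>
      \<i> * b * (q1 + q3) + u1 - u2 = 0 \<and> \<i> * b * q2 + u2 = 0 \<longleftrightarrow>
    u1 = - \<i> * b * (q1 + q2 + q3) \<and> u2 = - \<i> * b * q2 \<and> u3 = - \<i> * b * (q1 - q2 - q3)"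
    (is "?X1 = 0 \<and> ?X2 = 0 \<and> ?X3 = 0 \<and> ?X4 = 0 \<longleftrightarrow> u1 = ?f1 \<and> u2 = ?f2 \<and> u3 = ?f3")
    for q1 q2 q3 u1 u2 u3
  proof -
    define r1 r2 r3 where "r1 = u1 - ?f1" and "r2 = u2 - ?f2" and "r3 = u3 - ?f3"
    then have u: "u1 = ?f1 + r1" "u2 = ?f2 + r2" "u3 = ?f3 + r3"
      by simp_all
    \<comment> \<open>Four equations for three unknowns are consistent here:
      \<open>?X1 + ?X2 + ?X3 + 2 * ?X4\<close> vanishes identically. It is the trace of the
      coefficient against J^2, which is zero because K and J^2 commute.\<close>
    have X: "?X1 = - r2 - r3" "?X2 = r3 - r1" "?X3 = r1 - r2" "?X4 = r2"
      unfolding u by (simp_all add: algebra_simps)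
    show ?thesis
      unfolding X unfolding u by auto
  qed
  then show ?thesis
    unfolding v2_formula_def lax_coeff_3_eq_0_iff by simp
qed

text \<open>The equations involve the unknowns \<open>v 1 j\<close> only through their differences.
  Equal values of all four amount to a multiple of J, so \<open>v 1 4\<close> is free and takes the
  part of f.\<close>

lemma v1_formula_iff:
  assumes v: "\<And>j. j \<in> {1..3} \<Longrightarrow> smooth (v 2 j)"
    and q: "\<And>j. j \<in> {1..3} \<Longrightarrow> smooth (q j)"
    and v2: "v2_formula b q v"
  shows "(\<forall>x t. lax_coeff b q v 2 x t = 0) \<longleftrightarrow> v1_formula b q (v 1 4) v"
proof -
  have v': "\<forall>j\<in>{1..3}. smooth (v 2 j)"
    using v by blast
  have q': "x_diff (q 1)" "x_diff (q 2)" "x_diff (q 3)"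
    by (simp_all add: smooth_x_diff q)
  have v2': "v 2 1 = (\<lambda>x t. - \<i> * b * (q 1 x t + q 2 x t + q 3 x t))"
    "v 2 2 = (\<lambda>x t. - \<i> * b * q 2 x t)" "v 2 3 = (\<lambda>x t. - \<i> * b * (q 1 x t - q 2 x t - q 3 x t))"
    using v2 by (auto simp: v2_formula_def)
  have "- (\<i> * (- \<i> * b * (p1 - p2 - p3))) - \<i> * (q1 + q3) * (- \<i> * b * (q1 - q2 - q3)) - w2 + w4 = 0 \<and>
    - (\<i> * (- \<i> * b * (p1 + p2 + p3))) + \<i> * (q1 - q3) * (- \<i> * b * (q1 + q2 + q3)) - w1 + w2 = 0 \<and>
    - (\<i> * (- \<i> * b * p2)) + \<i> * (q2 + q3) * (- \<i> * b * q2) - w2 + w3 = 0 \<longleftrightarrow>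
    w1 = 2 * b * (q1 * q2 - p1) + w4 \<and>
    w2 = b * (q3^2 - q1^2 + q1 * q2 + q2 * q3 + (p3 + p2 - p1)) + w4 \<and>
    w3 = b * (q3^2 - q2^2 - q1^2 + q1 * q2 + (p3 + 2 * p2 - p1)) + w4"
    (is "?X1 = 0 \<and> ?X2 = 0 \<and> ?X3 = 0 \<longleftrightarrow> w1 = ?f1 \<and> w2 = ?f2 \<and> w3 = ?f3")
    for q1 q2 q3 p1 p2 p3 w1 w2 w3 w4
  proof -
    define r1 r2 r3 where "r1 = w1 - ?f1" and "r2 = w2 - ?f2" and "r3 = w3 - ?f3"
    then have w: "w1 = ?f1 + r1" "w2 = ?f2 + r2" "w3 = ?f3 + r3"
      by simp_all
    have X: "?X1 = - r2" "?X2 = r2 - r1" "?X3 = r3 - r2"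
      unfolding w by (simp_all add: algebra_simps power2_eq_square)
    show ?thesis
      unfolding X unfolding w by auto
  qed
  \<comment> \<open>The instantiation follows the order of first occurrence in the statement: p1,
    p2, p3, q1, q3, q2.\<close>
  note solve = this[of "Dx (q 1) x t" "Dx (q 2) x t" "Dx (q 3) x t" "q 1 x t" "q 3 x t" "q 2 x t" for x t]
  have D: "Dx (v 2 1) = (\<lambda>x t. - \<i> * b * (Dx (q 1) x t + Dx (q 2) x t + Dx (q 3) x t))"
    "Dx (v 2 2) = (\<lambda>x t. - \<i> * b * Dx (q 2) x t)"
    "Dx (v 2 3) = (\<lambda>x t. - \<i> * b * (Dx (q 1) x t - Dx (q 2) x t - Dx (q 3) x t))"
    "Dx (\<lambda>x t. q 3 x t + q 2 x t - q 1 x t) = (\<lambda>x t. Dx (q 3) x t + Dx (q 2) x t - Dx (q 1) x t)"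
    "Dx (\<lambda>x t. q 3 x t + 2 * q 2 x t - q 1 x t) = (\<lambda>x t. Dx (q 3) x t + 2 * Dx (q 2) x t - Dx (q 1) x t)"
    unfolding v2' by (simp_all add: Dx_rules q' del: One_nat_def)
  show ?thesis
    unfolding v1_formula_def lax_coeff_2_eq_0_iff[where v = v, OF v'] D unfolding v2' by (simp only: solve simp_thms)
qed

text \<open>The combination \<open>X1 + X2 + 2 * X3 + X4\<close> of the four equations is free of \<open>z1, z2, z3\<close>; it reads
  \<open>5 * \<i> * c' = 0\<close>, where c is the deviation of f from \<^const>\<open>f_mkdv\<close>.\<close>

lemma v0_solve:
  fixes b c c' q1 q2 q3 p1 p2 p3 s1 s2 s3 :: complex
  assumes f: "f = b / 5 * (2 * q2^2 + 2 * q1^2 - 3 * q3^2 - 5 * q1 * q2 + (5 * p1 - 4 * p2 - 3 * p3)) + c"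
    and f': "f' = b / 5 * (4 * q2 * p2 + 4 * q1 * p1 - 6 * q3 * p3 - 5 * p1 * q2 - 5 * q1 * p2
        + (5 * s1 - 4 * s2 - 3 * s3)) + c'"
    and w1: "w1 = 2 * b * (q1 * q2 - p1) + f"
    and w2: "w2 = b * (q3^2 - q1^2 + q1 * q2 + q2 * q3 + (p3 + p2 - p1)) + f"
    and w3: "w3 = b * (q3^2 - q2^2 - q1^2 + q1 * q2 + (p3 + 2 * p2 - p1)) + f"
    and w1': "w1' = 2 * b * (p1 * q2 + q1 * p2 - s1) + f'"
    and w2': "w2' = b * (2 * q3 * p3 - 2 * q1 * p1 + p1 * q2 + q1 * p2 + p2 * q3 + q2 * p3
        + (s3 + s2 - s1)) + f'"
    and w3': "w3' = b * (2 * q3 * p3 - 2 * q2 * p2 - 2 * q1 * p1 + p1 * q2 + q1 * p2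
        + (s3 + 2 * s2 - s1)) + f'"
  shows "\<i> * f' + \<i> * (q1 + q2) * f + z1 + z2 = 0 \<and>
      \<i> * w1' - \<i> * (q1 - q2) * w1 - z1 + z2 = 0 \<and>
      \<i> * w2' - \<i> * (q2 - q3) * w2 - z2 + z3 = 0 \<and>
      \<i> * w3' - 2 * \<i> * q3 * w3 - 2 * z3 = 0 \<longleftrightarrow>
    c' = 0 \<and>
      z1 = \<i> * b / 5 * (- 5 * s1 + 3 * q1 * (3 * p2 + p3) - 2 * q1^3 + 3 * q1 * (q2^2 + q3^2))
        - \<i> * c * q1 \<and>
      z2 = \<i> * b / 5 * ((4 * s2 + 3 * s3) + 3 * q2 * p3 - 9 * q1 * p1 + 6 * q3 * p3 - 2 * q2^3
        + 3 * q2 * (q1^2 + q3^2)) - \<i> * c * q2 \<and>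
      z3 = \<i> * b / 5 * ((s3 + 3 * s2) - 6 * q3 * p2 - 3 * q1 * p1 - 3 * q2 * p2 - 2 * q3^3
        + 3 * q3 * (q1^2 + q2^2)) - \<i> * c * q3"
    (is "?X1 = 0 \<and> ?X2 = 0 \<and> ?X3 = 0 \<and> ?X4 = 0 \<longleftrightarrow> c' = 0 \<and> z1 = ?f1 \<and> z2 = ?f2 \<and> z3 = ?f3")
proof -
  define r1 r2 r3 where "r1 = z1 - ?f1" and "r2 = z2 - ?f2" and "r3 = z3 - ?f3"
  then have z: "z1 = ?f1 + r1" "z2 = ?f2 + r2" "z3 = ?f3 + r3"
    by simp_all
  \<comment> \<open>All terms in the q's cancel. What remains is the table of \<i> c' J - [J, R],
    where R is the diagonal matrix of the deviations r1, r2, r3.\<close>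
  have X: "?X1 = \<i> * c' + r1 + r2" "?X2 = \<i> * c' - r1 + r2" "?X3 = \<i> * c' - r2 + r3"
    "?X4 = \<i> * c' - 2 * r3"
    unfolding z w1 w2 w3 w1' w2' w3' f f'
    by (simp_all add: field_simps power2_eq_square power3_eq_cube)
  have "c' = 0" if "?X1 = 0 \<and> ?X2 = 0 \<and> ?X3 = 0 \<and> ?X4 = 0"
  proof -
    \<comment> \<open>The weights 1, 1, 2, 1 are those of the trace against J^4: it annihilates
      [J, R] and turns \<i> c' J into 5 \<i> c'.\<close>
    have "5 * \<i> * c' = ?X1 + ?X2 + 2 * ?X3 + ?X4"
      unfolding X by (simp add: algebra_simps)
    with that show ?thesis by simp
  qed
  moreover have "?X1 = 0 \<and> ?X2 = 0 \<and> ?X3 = 0 \<and> ?X4 = 0 \<longleftrightarrow> r1 = 0 \<and> r2 = 0 \<and> r3 = 0"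
    if "c' = 0"
    unfolding X that by auto
  ultimately show ?thesis
    unfolding r1_def r2_def r3_def by auto
qed

lemma f_mkdv_expand:
  assumes "x_diff (q 1)" "x_diff (q 2)" "x_diff (q 3)"
  shows "f_mkdv b q = (\<lambda>x t. b / 5 * (2 * (q 2 x t)^2 + 2 * (q 1 x t)^2 - 3 * (q 3 x t)^2
    - 5 * q 1 x t * q 2 x t + (5 * Dx (q 1) x t - 4 * Dx (q 2) x t - 3 * Dx (q 3) x t)))"
  unfolding f_mkdv_def by (simp add: Dx_rules assms del: One_nat_def)

lemma Fj_expand:
  assumes "x_diff (q 1)" "x_diff (q 2)" "x_diff (q 3)"
    and "x_diff (Dx (q 1))" "x_diff (Dx (q 2))" "x_diff (Dx (q 3))"
  shows "Fj q 1 = (\<lambda>x t. - 5 * Dx (Dx (q 1)) x t + 3 * q 1 x t * (3 * Dx (q 2) x t + Dx (q 3) x t)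
      - 2 * (q 1 x t)^3 + 3 * q 1 x t * ((q 2 x t)^2 + (q 3 x t)^2))"
    and "Fj q 2 = (\<lambda>x t. (4 * Dx (Dx (q 2)) x t + 3 * Dx (Dx (q 3)) x t) + 3 * q 2 x t * Dx (q 3) x t
      - 9 * q 1 x t * Dx (q 1) x t + 6 * q 3 x t * Dx (q 3) x t
      - 2 * (q 2 x t)^3 + 3 * q 2 x t * ((q 1 x t)^2 + (q 3 x t)^2))"
    and "Fj q 3 = (\<lambda>x t. (Dx (Dx (q 3)) x t + 3 * Dx (Dx (q 2)) x t) - 6 * q 3 x t * Dx (q 2) x t
      - 3 * q 1 x t * Dx (q 1) x t - 3 * q 2 x t * Dx (q 2) x t
      - 2 * (q 3 x t)^3 + 3 * q 3 x t * ((q 1 x t)^2 + (q 2 x t)^2))"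
  unfolding Fj_def F1_def F2_def F3_def by (simp_all add: Dx_rules assms del: One_nat_def)

lemma x_diff_Fj:
  assumes "\<And>j. j \<in> {1..3} \<Longrightarrow> smooth (q j)" and "j \<in> {1..3}"
  shows "x_diff (Fj q j)"
proof -
  have q: "x_diff (q 1)" "x_diff (q 2)" "x_diff (q 3)"
    "x_diff (Dx (q 1))" "x_diff (Dx (q 2))" "x_diff (Dx (q 3))"
    "x_diff (Dx (Dx (q 1)))" "x_diff (Dx (Dx (q 2)))" "x_diff (Dx (Dx (q 3)))"
    by (simp_all add: smooth_x_diff smooth_Dx assms)
  have "\<forall>j\<in>{1..3}. x_diff (Fj q j)"
    unfolding all_1_3 Fj_expand[OF q(1-6)] power2_eq_square power3_eq_cube
    by (intro conjI x_diff_add x_diff_diff x_diff_mult x_diff_uminus q x_diff_const)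
  with assms show ?thesis by blast
qed

lemma v0_formula_iff:
  assumes v: "\<And>j. j \<in> {1..4} \<Longrightarrow> smooth (v 1 j)"
    and q: "\<And>j. j \<in> {1..3} \<Longrightarrow> smooth (q j)"
    and v1: "v1_formula b q (v 1 4) v"
  shows "(\<forall>x t. lax_coeff b q v 1 x t = 0) \<longleftrightarrow>
    (\<exists>c. (\<forall>x t. v 1 4 x t = f_mkdv b q x t + c t) \<and> v0_formula_const b q c v)"
proof -
  have v': "\<forall>j\<in>{1..4}. smooth (v 1 j)"
    using v by blast
  have q': "x_diff (q 1)" "x_diff (q 2)" "x_diff (q 3)"
    "x_diff (Dx (q 1))" "x_diff (Dx (q 2))" "x_diff (Dx (q 3))"
    and v14: "x_diff (v 1 4)"
    by (simp_all add: smooth_x_diff smooth_Dx q v del: One_nat_def)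
  note D = Dx_rules q' v14
  \<comment> \<open>At first c may depend on x as well; that it does not is part of what the
    relation says.\<close>
  define c where "c = (\<lambda>x t. v 1 4 x t - f_mkdv b q x t)"
  have c: "x_diff c"
    unfolding c_def f_mkdv_expand[OF q'(1-3)] by (simp only: D)
  have f: "v 1 4 = (\<lambda>x t. b / 5 * (2 * (q 2 x t)^2 + 2 * (q 1 x t)^2 - 3 * (q 3 x t)^2
      - 5 * q 1 x t * q 2 x t + (5 * Dx (q 1) x t - 4 * Dx (q 2) x t - 3 * Dx (q 3) x t)) + c x t)"
    unfolding c_def f_mkdv_expand[OF q'(1-3)] by simp
  have w1: "v 1 1 = (\<lambda>x t. 2 * b * (q 1 x t * q 2 x t - Dx (q 1) x t) + v 1 4 x t)"
    and w2: "v 1 2 = (\<lambda>x t. b * ((q 3 x t)^2 - (q 1 x t)^2 + q 1 x t * q 2 x t + q 2 x t * q 3 x t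
      + (Dx (q 3) x t + Dx (q 2) x t - Dx (q 1) x t)) + v 1 4 x t)"
    and w3: "v 1 3 = (\<lambda>x t. b * ((q 3 x t)^2 - (q 2 x t)^2 - (q 1 x t)^2 + q 1 x t * q 2 x t
      + (Dx (q 3) x t + 2 * Dx (q 2) x t - Dx (q 1) x t)) + v 1 4 x t)"
    using v1 unfolding v1_formula_def fun_eq_iff by (simp_all add: D del: One_nat_def)
  have f': "Dx (v 1 4) x t = b / 5 * (4 * q 2 x t * Dx (q 2) x t + 4 * q 1 x t * Dx (q 1) x t
      - 6 * q 3 x t * Dx (q 3) x t - 5 * Dx (q 1) x t * q 2 x t - 5 * q 1 x t * Dx (q 2) x t
      + (5 * Dx (Dx (q 1)) x t - 4 * Dx (Dx (q 2)) x t - 3 * Dx (Dx (q 3)) x t)) + Dx c x t" for x t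
    by (subst f, simp only: D c) (simp add: field_simps)
  have w1': "Dx (v 1 1) x t = 2 * b * (Dx (q 1) x t * q 2 x t + q 1 x t * Dx (q 2) x t
      - Dx (Dx (q 1)) x t) + Dx (v 1 4) x t" for x t
    by (subst w1, simp only: D) (simp add: field_simps)
  have w2': "Dx (v 1 2) x t = b * (2 * q 3 x t * Dx (q 3) x t - 2 * q 1 x t * Dx (q 1) x t
      + Dx (q 1) x t * q 2 x t + q 1 x t * Dx (q 2) x t + Dx (q 2) x t * q 3 x t + q 2 x t * Dx (q 3) x t
      + (Dx (Dx (q 3)) x t + Dx (Dx (q 2)) x t - Dx (Dx (q 1)) x t)) + Dx (v 1 4) x t" for x t
    by (subst w2, simp only: D) (simp add: field_simps)
  have w3': "Dx (v 1 3) x t = b * (2 * q 3 x t * Dx (q 3) x t - 2 * q 2 x t * Dx (q 2) x t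
      - 2 * q 1 x t * Dx (q 1) x t + Dx (q 1) x t * q 2 x t + q 1 x t * Dx (q 2) x t
      + (Dx (Dx (q 3)) x t + 2 * Dx (Dx (q 2)) x t - Dx (Dx (q 1)) x t)) + Dx (v 1 4) x t" for x t
    by (subst w3, simp only: D) (simp add: field_simps)
  have "lax_coeff b q v 1 x t = 0 \<longleftrightarrow>
    Dx c x t = 0 \<and> (\<forall>j\<in>{1..3}. v 0 j x t = \<i> * b / 5 * Fj q j x t - \<i> * c x t * q j x t)" for x t
    unfolding lax_coeff_1_eq_0_iff[where v = v, OF v'] all_1_3 Fj_expand[OF q']
    by (rule v0_solve[OF fun_cong[OF fun_cong[OF f]] f' fun_cong[OF fun_cong[OF w1]]
      fun_cong[OF fun_cong[OF w2]] fun_cong[OF fun_cong[OF w3]] w1' w2' w3'])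
  then have pointwise: "(\<forall>x t. lax_coeff b q v 1 x t = 0) \<longleftrightarrow> (\<forall>x t. Dx c x t = 0 \<and>
    (\<forall>j\<in>{1..3}. v 0 j x t = \<i> * b / 5 * Fj q j x t - \<i> * c x t * q j x t))"
    by blast
  show ?thesis
  proof
    assume "\<forall>x t. lax_coeff b q v 1 x t = 0"
    then have 0: "\<forall>x t. Dx c x t = 0 \<and>
      (\<forall>j\<in>{1..3}. v 0 j x t = \<i> * b / 5 * Fj q j x t - \<i> * c x t * q j x t)"
      using pointwise by blast
    \<comment> \<open>The value at x = 0 serves as the integration constant.\<close>
    then have c0: "c x t = c 0 t" for x t
      by (intro Dx_eq_0_imp_const[OF c]) blast
    have "v 1 4 x t = f_mkdv b q x t + c 0 t" for x t
      using c0[of x t] unfolding c_def by (simp add: algebra_simps)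
    moreover have "v 0 j x t = \<i> * b / 5 * Fj q j x t - \<i> * c 0 t * q j x t" if "j \<in> {1..3}" for j x t
      using 0 that unfolding c0[of x t, symmetric] by blast
    then have "v0_formula_const b q (c 0) v"
      unfolding v0_formula_const_def by blast
    ultimately
    show "\<exists>c. (\<forall>x t. v 1 4 x t = f_mkdv b q x t + c t) \<and> v0_formula_const b q c v"
      by blast
  next
    assume "\<exists>c. (\<forall>x t. v 1 4 x t = f_mkdv b q x t + c t) \<and> v0_formula_const b q c v"
    then obtain k where "\<forall>x t. v 1 4 x t = f_mkdv b q x t + k t" and k: "v0_formula_const b q k v"
      by blast
    then have "c = (\<lambda>x t. k t)"
      unfolding c_def by simp
    with k show "\<forall>x t. lax_coeff b q v 1 x t = 0"
      unfolding pointwise by (simp add: Dx_const v0_formula_const_def)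
  qed
qed

text \<open>The factor \<i> of the x-derivative meets \<i> b / 5 in \<open>v 0 j\<close>, so the
  scalar equation is b / 5 times the evolution equation; dividing by it yields \<alpha> = 5 /
  b.\<close>

lemma mkdv_const_iff:
  assumes b: "b \<noteq> 0"
    and v: "\<And>j. j \<in> {1..3} \<Longrightarrow> smooth (v 0 j)" and q: "\<And>j. j \<in> {1..3} \<Longrightarrow> smooth (q j)"
    and v0: "v0_formula_const b q c v"
  shows "(\<forall>x t. lax_coeff b q v 0 x t = 0) \<longleftrightarrow> mkdv_const (5 / b) q c"
proof -
  have v': "\<forall>j\<in>{1..3}. smooth (v 0 j)" and qs: "\<forall>j\<in>{1..3}. smooth (q j)"
    using v q by blast+
  have "\<i> * Dx (v 0 j) x t + Dt (q j) x t = 0 \<longleftrightarrow>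
    5 / b * Dt (q j) x t = Dx (Fj q j) x t - 5 / b * c t * Dx (q j) x t" if j: "j \<in> {1..3}" for j x t
  proof -
    have "v 0 j = (\<lambda>x t. \<i> * b / 5 * Fj q j x t - \<i> * c t * q j x t)"
      using v0 j by (auto simp: v0_formula_const_def fun_eq_iff)
    then have Dv: "Dx (v 0 j) x t = \<i> * b / 5 * Dx (Fj q j) x t - \<i> * c t * Dx (q j) x t"
      by (simp only: Dx_rules x_diff_Fj[OF q j] smooth_x_diff[OF q[OF j]]) simp
    then have "\<i> * Dx (v 0 j) x t + Dt (q j) x t
      = b / 5 * (5 / b * Dt (q j) x t - (Dx (Fj q j) x t - 5 / b * c t * Dx (q j) x t))"
      unfolding Dv using b by (simp add: field_simps)
    then have "\<i> * Dx (v 0 j) x t + Dt (q j) x t = 0 \<longleftrightarrow>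
      5 / b * Dt (q j) x t - (Dx (Fj q j) x t - 5 / b * c t * Dx (q j) x t) = 0"
      using b by (simp only: mult_eq_0_iff divide_eq_0_iff) simp
    then show ?thesis by (simp only: eq_iff_diff_eq_0[of "5 / b * Dt (q j) x t"])
  qed
  then show ?thesis
    unfolding lax_coeff_0_eq_0_iff[where v = v and q = q, OF v' qs] mkdv_const_def by blast
qed

section \<open>The integration constant and the combined equivalences\<close>

lemma v0_formula_const_0: "v0_formula_const b q (\<lambda>t. 0) v \<longleftrightarrow> v0_formula b q v"
  by (simp add: v0_formula_const_def v0_formula_def)

lemma mkdv_const_0: "mkdv_const \<alpha> q (\<lambda>t. 0) \<longleftrightarrow> mkdv \<alpha> q"
  by (simp add: mkdv_const_def mkdv_def)

text \<open>\<open>f_mkdv\<close> contains only the q's and their first x-derivatives, so it tends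
  to 0 together with f; their difference is constant in x and must equal its limit.\<close>

lemma vanishing_bc_imp_const_0:
  assumes q: "\<And>j. j \<in> {1..3} \<Longrightarrow> smooth (q j)"
    and bc: "vanishing_bc q f" and f: "\<And>x t. f x t = f_mkdv b q x t + c t"
  shows "c t = 0"
proof -
  have q': "x_diff (q 1)" "x_diff (q 2)" "x_diff (q 3)"
    by (simp_all add: smooth_x_diff q)
  have lim: "((\<lambda>x. q j x t) \<longlongrightarrow> 0) at_bot" "((\<lambda>x. Dx (q j) x t) \<longlongrightarrow> 0) at_bot"
    if "j \<in> {1, 2, 3}" for j
    using bc that by (auto simp: vanishing_bc_def)
  have "((\<lambda>x. f_mkdv b q x t) \<longlongrightarrow> b / 5 * (2 * 0^2 + 2 * 0^2 - 3 * 0^2 - 5 * 0 * 0 + (5 * 0 - 4 * 0 - 3 * 0))) at_bot"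
    unfolding f_mkdv_expand[OF q'] by (intro tendsto_intros lim) auto
  \<comment> \<open>The limit is left unevaluated so that its form follows the expanded expression
    term by term.\<close>
  moreover have "((\<lambda>x. f x t) \<longlongrightarrow> 0) at_bot"
    using bc by (simp add: vanishing_bc_def)
  ultimately have "((\<lambda>x. f x t - f_mkdv b q x t) \<longlongrightarrow> 0 - 0) at_bot"
    by (intro tendsto_diff) simp_all
  then have "((\<lambda>x. c t) \<longlongrightarrow> 0) (at_bot :: real filter)"
    by (simp add: f)
  then show ?thesis
    by (simp add: tendsto_const_iff)
qed

lemma v1_formula_v14: "v1_formula b q f v \<Longrightarrow> v 1 4 = f"
  by (auto simp: v1_formula_def fun_eq_iff)

theorem mainTheorem1:
  fixes b \<alpha> :: complex
    and q :: "nat \<Rightarrow> complex field2"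
    and v :: "nat \<Rightarrow> nat \<Rightarrow> complex field2"
  assumes b: "b \<noteq> 0" and \<alpha>: "\<alpha> = 5 / b"
    and smooth_q: "\<And>j. j \<in> {1..3} \<Longrightarrow> smooth (q j)"
    and smooth_v0: "\<And>j. j \<in> {1..3} \<Longrightarrow> smooth (v 0 j)"
    and smooth_v1: "\<And>j. j \<in> {1..4} \<Longrightarrow> smooth (v 1 j)"
    and smooth_v2: "\<And>j. j \<in> {1..3} \<Longrightarrow> smooth (v 2 j)"
  shows
    \<comment> \<open>[L,M] is a polynomial in the spectral parameter, whose coefficients give the recurrent relations\<close>
    "(\<forall>\<zeta> \<psi> x t. smooth \<psi> \<longrightarrow>
        op_comm (lax_L q \<zeta>) (lax_M b v \<zeta>) \<psi> x t
          = (\<Sum>k\<le>4. \<zeta>^k *\<^sub>M lax_coeff b q v k x t) *v \<psi> x t)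
     \<and> (lax_commute b q v \<longleftrightarrow> (\<forall>k\<le>4. \<forall>x t. lax_coeff b q v k x t = 0))
     \<and> (\<forall>x t. lax_coeff b q v 4 x t = 0)
     \<comment> \<open>the recurrent relation for V(2)\<close>
     \<and> ((\<forall>x t. lax_coeff b q v 3 x t = 0) \<longleftrightarrow> v2_formula b q v)
     \<comment> \<open>the recurrent relation for V(1), with f arbitrary\<close>
     \<and> (v2_formula b q v \<longrightarrow>
          ((\<forall>x t. lax_coeff b q v 2 x t = 0) \<longleftrightarrow> (\<exists>f. v1_formula b q f v)))
     \<comment> \<open>the recurrent relation for V(0), which also gives f up to an integration constant c(t)\<close>
     \<and> (\<forall>f. v2_formula b q v \<and> v1_formula b q f v \<longrightarrow>
          ((\<forall>x t. lax_coeff b q v 1 x t = 0) \<longleftrightarrow>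
             (\<exists>c. (\<forall>x t. f x t = f_mkdv b q x t + c t) \<and> v0_formula_const b q c v)))
     \<and> (v2_formula b q v \<and> v1_formula b q (f_mkdv b q) v \<longrightarrow>
          ((\<forall>x t. lax_coeff b q v 1 x t = 0) \<longleftrightarrow> v0_formula b q v))
     \<comment> \<open>the terms independent of the spectral parameter\<close>
     \<and> (\<forall>c. v0_formula_const b q c v \<longrightarrow>
          ((\<forall>x t. lax_coeff b q v 0 x t = 0) \<longleftrightarrow> mkdv_const \<alpha> q c))
     \<and> (v0_formula b q v \<longrightarrow> ((\<forall>x t. lax_coeff b q v 0 x t = 0) \<longleftrightarrow> mkdv \<alpha> q))
     \<comment> \<open>altogether, for a general integration constant\<close>
     \<and> (lax_commute b q v \<longleftrightarrow>
          (\<exists>c. v2_formula b q v \<and> v1_formula b q (\<lambda>x t. f_mkdv b q x t + c t) v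
               \<and> v0_formula_const b q c v \<and> mkdv_const \<alpha> q c))
     \<comment> \<open>and for integration constant zero, in particular under vanishing boundary conditions\<close>
     \<and> (lax_commute b q v \<and> (\<forall>t. \<exists>x. v 1 4 x t = f_mkdv b q x t) \<longleftrightarrow>
          v2_formula b q v \<and> v1_formula b q (f_mkdv b q) v \<and> v0_formula b q v \<and> mkdv \<alpha> q)
     \<and> (vanishing_bc q (v 1 4) \<longrightarrow>
          (lax_commute b q v \<longleftrightarrow>
             v2_formula b q v \<and> v1_formula b q (f_mkdv b q) v \<and> v0_formula b q v \<and> mkdv \<alpha> q))"
proof -
  have comm_eq: "\<forall>\<zeta> \<psi> x t. smooth \<psi> \<longrightarrow>
      op_comm (lax_L q \<zeta>) (lax_M b v \<zeta>) \<psi> x t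
        = (\<Sum>k\<le>4. \<zeta>^k *\<^sub>M lax_coeff b q v k x t) *v \<psi> x t"
    by (intro allI impI op_comm_lax smooth_q smooth_v0 smooth_v1 smooth_v2)
  then have comm: "lax_commute b q v \<longleftrightarrow> (\<forall>k\<le>4. \<forall>x t. lax_coeff b q v k x t = 0)"
    by (intro lax_commute_iff) blast
  have c4: "\<forall>x t. lax_coeff b q v 4 x t = 0"
    by (simp add: lax_coeff_4)
  have c3: "(\<forall>x t. lax_coeff b q v 3 x t = 0) \<longleftrightarrow> v2_formula b q v"
    by (rule v2_formula_iff)
  have c2: "v2_formula b q v \<longrightarrow>
      ((\<forall>x t. lax_coeff b q v 2 x t = 0) \<longleftrightarrow> (\<exists>f. v1_formula b q f v))"
  proof
    assume "v2_formula b q v"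
    then have "(\<forall>x t. lax_coeff b q v 2 x t = 0) \<longleftrightarrow> v1_formula b q (v 1 4) v"
      by (intro v1_formula_iff smooth_v2 smooth_q)
    then show "(\<forall>x t. lax_coeff b q v 2 x t = 0) \<longleftrightarrow> (\<exists>f. v1_formula b q f v)"
      using v1_formula_v14 by blast
  qed
  have c1: "\<forall>f. v2_formula b q v \<and> v1_formula b q f v \<longrightarrow>
      ((\<forall>x t. lax_coeff b q v 1 x t = 0) \<longleftrightarrow>
        (\<exists>c. (\<forall>x t. f x t = f_mkdv b q x t + c t) \<and> v0_formula_const b q c v))"
  proof (intro allI impI)
    fix f assume "v2_formula b q v \<and> v1_formula b q f v"
    then have f: "f = v 1 4" and "v1_formula b q (v 1 4) v"
      using v1_formula_v14 by blast+
    then show "(\<forall>x t. lax_coeff b q v 1 x t = 0) \<longleftrightarrow>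
        (\<exists>c. (\<forall>x t. f x t = f_mkdv b q x t + c t) \<and> v0_formula_const b q c v)"
      unfolding f by (intro v0_formula_iff smooth_v1 smooth_q)
  qed
  have c1': "v2_formula b q v \<and> v1_formula b q (f_mkdv b q) v \<longrightarrow>
      ((\<forall>x t. lax_coeff b q v 1 x t = 0) \<longleftrightarrow> v0_formula b q v)"
  proof
    assume "v2_formula b q v \<and> v1_formula b q (f_mkdv b q) v"
    with c1 have "(\<forall>x t. lax_coeff b q v 1 x t = 0) \<longleftrightarrow>
        (\<exists>c. (\<forall>x t. f_mkdv b q x t = f_mkdv b q x t + c t) \<and> v0_formula_const b q c v)"
      by blast
    \<comment> \<open>With f already equal to \<open>f_mkdv\<close>, the only possible integration
      constant is zero.\<close>
    also have "\<dots> \<longleftrightarrow> (\<exists>c. c = (\<lambda>t. 0) \<and> v0_formula_const b q c v)"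
      by (simp add: fun_eq_iff)
    finally show "(\<forall>x t. lax_coeff b q v 1 x t = 0) \<longleftrightarrow> v0_formula b q v"
      by (simp add: v0_formula_const_0)
  qed
  have c0: "\<forall>c. v0_formula_const b q c v \<longrightarrow>
      ((\<forall>x t. lax_coeff b q v 0 x t = 0) \<longleftrightarrow> mkdv_const \<alpha> q c)"
    unfolding \<alpha> by (intro allI impI mkdv_const_iff b smooth_v0 smooth_q)
  then have c0': "v0_formula b q v \<longrightarrow> ((\<forall>x t. lax_coeff b q v 0 x t = 0) \<longleftrightarrow> mkdv \<alpha> q)"
    by (metis v0_formula_const_0 mkdv_const_0)
  have "(\<forall>k\<le>4. P k) \<longleftrightarrow> P 0 \<and> P 1 \<and> P 2 \<and> P 3 \<and> P 4" for P :: "nat \<Rightarrow> bool"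
    by (auto simp: numeral_eq_Suc le_Suc_eq)
  with comm c4 have comm': "lax_commute b q v \<longleftrightarrow>
      (\<forall>x t. lax_coeff b q v 0 x t = 0) \<and> (\<forall>x t. lax_coeff b q v 1 x t = 0) \<and>
      (\<forall>x t. lax_coeff b q v 2 x t = 0) \<and> (\<forall>x t. lax_coeff b q v 3 x t = 0)"
    by presburger
  have general: "lax_commute b q v \<longleftrightarrow>
      (\<exists>c. v2_formula b q v \<and> v1_formula b q (\<lambda>x t. f_mkdv b q x t + c t) v
        \<and> v0_formula_const b q c v \<and> mkdv_const \<alpha> q c)"
  proof
    assume *: "lax_commute b q v"
    then have v2: "v2_formula b q v"
      using comm' c3 by blast
    with * obtain f where f: "v1_formula b q f v"
      using comm' c2 by blast
    with * v2 obtain c where "\<forall>x t. f x t = f_mkdv b q x t + c t" and v0: "v0_formula_const b q c v"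
      using comm' c1[rule_format, of f] by auto
    then have "f = (\<lambda>x t. f_mkdv b q x t + c t)"
      by (simp add: fun_eq_iff)
    with f v0 v2 * show "\<exists>c. v2_formula b q v \<and> v1_formula b q (\<lambda>x t. f_mkdv b q x t + c t) v
        \<and> v0_formula_const b q c v \<and> mkdv_const \<alpha> q c"
      using comm' c0 by blast
  next
    assume "\<exists>c. v2_formula b q v \<and> v1_formula b q (\<lambda>x t. f_mkdv b q x t + c t) v
        \<and> v0_formula_const b q c v \<and> mkdv_const \<alpha> q c"
    then obtain c where v: "v2_formula b q v" "v1_formula b q (\<lambda>x t. f_mkdv b q x t + c t) v"
      "v0_formula_const b q c v" "mkdv_const \<alpha> q c"
      by blast
    then have "\<forall>x t. lax_coeff b q v 1 x t = 0"
      using c1[rule_format, of "\<lambda>x t. f_mkdv b q x t + c t"] by blast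
    with v show "lax_commute b q v"
      using comm' c0 c2 c3 by blast
  qed
  have special: "v2_formula b q v \<and> v1_formula b q (f_mkdv b q) v \<and> v0_formula b q v \<and> mkdv \<alpha> q"
    if "v2_formula b q v" "v1_formula b q (\<lambda>x t. f_mkdv b q x t + c t) v"
      "v0_formula_const b q c v" "mkdv_const \<alpha> q c" "\<And>t. c t = 0" for c
  proof -
    have "c = (\<lambda>t. 0)"
      using that(5) by blast
    with that show ?thesis
      by (simp add: v0_formula_const_0 mkdv_const_0)
  qed
  have zero: "lax_commute b q v \<and> (\<forall>t. \<exists>x. v 1 4 x t = f_mkdv b q x t) \<longleftrightarrow>
      v2_formula b q v \<and> v1_formula b q (f_mkdv b q) v \<and> v0_formula b q v \<and> mkdv \<alpha> q"
  proof
    assume *: "lax_commute b q v \<and> (\<forall>t. \<exists>x. v 1 4 x t = f_mkdv b q x t)"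
    then obtain c where c: "v2_formula b q v" "v1_formula b q (\<lambda>x t. f_mkdv b q x t + c t) v"
      "v0_formula_const b q c v" "mkdv_const \<alpha> q c"
      using general by blast
    \<comment> \<open>Since c does not depend on x, agreement of \<open>v 1 4\<close> with
      \<open>f_mkdv\<close> at a single x for each t is enough.\<close>
    have "c t = 0" for t
      using * v1_formula_v14[OF c(2)] by (metis add_cancel_left_right)
    with c show "v2_formula b q v \<and> v1_formula b q (f_mkdv b q) v \<and> v0_formula b q v \<and> mkdv \<alpha> q"
      by (rule special)
  next
    assume *: "v2_formula b q v \<and> v1_formula b q (f_mkdv b q) v \<and> v0_formula b q v \<and> mkdv \<alpha> q"
    then have "lax_commute b q v"
      unfolding general by (intro exI[of _ "\<lambda>t. 0"]) (simp add: v0_formula_const_0 mkdv_const_0)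
    with * show "lax_commute b q v \<and> (\<forall>t. \<exists>x. v 1 4 x t = f_mkdv b q x t)"
      using v1_formula_v14 by metis
  qed
  have vanishing: "vanishing_bc q (v 1 4) \<longrightarrow>
      (lax_commute b q v \<longleftrightarrow>
        v2_formula b q v \<and> v1_formula b q (f_mkdv b q) v \<and> v0_formula b q v \<and> mkdv \<alpha> q)"
  proof (intro impI iffI)
    assume bc: "vanishing_bc q (v 1 4)" and "lax_commute b q v"
    then obtain c where c: "v2_formula b q v" "v1_formula b q (\<lambda>x t. f_mkdv b q x t + c t) v"
      "v0_formula_const b q c v" "mkdv_const \<alpha> q c"
      using general by blast
    have "c t = 0" for t
      using smooth_q bc by (rule vanishing_bc_imp_const_0) (simp_all add: v1_formula_v14[OF c(2)] del: One_nat_def)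
    with c show "v2_formula b q v \<and> v1_formula b q (f_mkdv b q) v \<and> v0_formula b q v \<and> mkdv \<alpha> q"
      by (rule special)
  qed (use zero in blast)
  show ?thesis
    by (intro conjI comm_eq comm c4 c3 c2 c1 c1' c0 c0' general zero vanishing)
qed

end
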